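(* Let $G$ be a rigid group in $\mathcal{A}_0$ with an $rc$-basis $E_0$, extended to an $r$-basis $E=\{e_\tau\mid\tau\in T(G)\}$ of $G$. Let elements $U_*,U_\times\in M_G(E_0)$ determine the rings $(G,* )$ and $(G,\times)$ on $G$, respectively. Then $(G,* )\cong(G,\times)$ (as rings) if and only if there exists an element $c\in K_G^*$ such that $U_*=cU_\times$.
   Context: All groups are additively written Abelian groups. A multiplication on a group $G$ is a homomorphism $G\otimes G\to G$ (no associativity, commutativity or identity is required); a multiplication $\times$ defines a ring $(G,\times)$ on $G$. $\mathrm{Mult}\,G$ is the additive group of all multiplications on $G$. A torsion-free group $G$ of finite rank is almost completely decomposable (ACD) if it contains a completely decomposable subgroup (a direct sum of rank-1 groups) of finite index. Its regulator $\mathrm{Reg}\,G$ is the intersection of all its completely decomposable subgroups of least index; it is a completely decomposable, fully invariant subgroup of finite index. For a type $\tau$, $\mathrm{Reg}_\tau G$ denotes the sum of the rank-1 direct summands of type $\tau$ in a given decomposition of $\mathrm{Reg}\,G$ into rank-1 summands, and $T(G)=\{\tau\mid \mathrm{Reg}_\tau G\neq0\}$. $G$ is block-rigid if the types in $T(G)$ are pairwise incomparable (then the $\mathrm{Reg}_\tau G$ are uniquely determined); it is rigid if moreover each $\mathrm{Reg}_\tau G$ ($\tau\in T(G)$) has rank 1. $G$ is of ring type if all types in $T(G)$ are idempotent. $\mathcal{A}_0$ is the class of block-rigid ACD groups of ring type with cyclic quotient $G/\mathrm{Reg}\,G$. Let $G\in\mathcal{A}_0$ be rigid, $A=\mathrm{Reg}\,G$,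 $A_\tau=\mathrm{Reg}_\tau G$, $T=T(G)$. The divisible hull is $\tilde G=\tilde A=\bigoplus_{\tau\in T}\tilde A_\tau$ with projections $\pi_\tau:\tilde G\to\tilde A_\tau$. If $G/A=\langle d+A\rangle$, then $m_\tau=m_\tau(G)$ is the order of $\pi_\tau(d)+A$ in $\tilde A/A$ (independent of $d$). $T_0=\{\tau\in T\mid m_\tau>1\}$. For $\tau\in T$, $P_\infty(\tau)=\{p \text{ prime}\mid\tau(p)=\infty\}$, $P_0(\tau)$ is the set of all other primes, and $R_\tau$ is the unital subring of $\mathbb{Q}$ whose additive group has type $\tau$. For a set $P_1$ of primes, a $P_1$-number is a nonzero integer all of whose prime divisors lie in $P_1$. There is a decomposition $G=G_1\oplus C$ (fixed; a main decomposition), with $C$ block-rigid completely decomposable and $G_1$ a rigid ACD group with cyclic regulator quotient such that $T(G_1)=T_0$ and $m_\tau(G_1)=m_\tau(G)$ for $\tau\in T_0$. Put $B=\mathrm{Reg}\,G_1$. An $rc$-basis of $G$ is a system $E_0=\{e_\tau\in \mathrm{Reg}_\tau G_1\mid\tau\in T_0\}$ with $B=\bigoplus_{\tau\in T_0}R_\tau e_\tau$ for which there is $d\in G_1$ with $G/A=\langle d+A\rangle$ and $$d=\sum_{\tau\in T_0}\frac{s_\tau}{m_\tau}e_\tau,$$ where, for all $\tau\in T_0$, $s_\tau,m_\tau$ are $P_0(\tau)$-numbers with $\gcd(s_\tau,m_\tau)=1$. An $r$-basis of $G$ extending $E_0$ is a system $E=\{e_\tau\in A_\tau\mid\tau\in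 T\}$ containing $E_0$ with $A=\bigoplus_{\tau\in T}R_\tau e_\tau$. Define $$M_G(E_0)=\langle X,M^{(2)}\rangle\subseteq\prod_{\tau\in T}m_\tau R_\tau e_\tau,\qquad X=(m_\tau s_\tau^{-1}e_\tau)_{\tau\in T_0},\qquad M^{(2)}=\prod_{\tau\in T}m_\tau^2R_\tau e_\tau,$$ where $s_\tau^{-1}$ is an integer inverse to $s_\tau$ modulo $m_\tau$ and the components of $X$ at $\tau\in T\setminus T_0$ are $0$. This group does not depend on the choice of $d$ and of the $s_\tau^{-1}$. It is known that there is an isomorphism $\mathrm{Mult}\,G\to M_G(E_0)$, $\times\mapsto U_\times=(u_\tau e_\tau)_{\tau\in T}$, where $e_\tau\times e_\tau=u_\tau e_\tau$ for each $\tau\in T$; an element $U\in M_G(E_0)$ determines the ring $(G,\times)$ if $U=U_\times$. Let $R_G=\prod_{\tau\in T}R_\tau$, let $1_{T_0}\in R_G$ have component $1$ at each $\tau\in T_0$ and $0$ at each $\tau\in T\setminus T_0$, and let $K_G$ be the subring $K_G=\mathbb{Z}1_{T_0}+\prod_{\tau\in T}m_\tau R_\tau$ of $R_G$ (a unital ring). $K_G^*$ is its group of units. $R_G$ (hence $K_G$) acts on $\prod_{\tau\in T}\mathbb{Q}e_\tau$ componentwise: $(r_\tau)_\tau\cdot(a_\tau e_\tau)_\tau=(r_\tau a_\tau e_\tau)_\tau$. *)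

theory Defs
  imports
    Complex_Main
    "HOL-Library.Extended_Nat"
    "HOL-Library.Function_Algebras"
    "HOL-Computational_Algebra.Primes"
    "HOL-Number_Theory.Cong"
begin

text \<open>
  A torsion-free abelian group is treated as a subgroup \<open>G\<close> of a vector space over the rationals;
  its divisible hull is then the rational span of \<open>G\<close>.
\<close>

class rat_vector = ab_group_add +
  fixes scaleQ :: "rat \<Rightarrow> 'a \<Rightarrow> 'a" (infixr "*\<^sub>Q" 75)
  assumes scaleQ_add_right: "a *\<^sub>Q (x + y) = a *\<^sub>Q x + a *\<^sub>Q y"
    and scaleQ_add_left: "(a + b) *\<^sub>Q x = a *\<^sub>Q x + b *\<^sub>Q x"
    and scaleQ_scaleQ: "a *\<^sub>Q b *\<^sub>Q x = (a * b) *\<^sub>Q x"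
    and scaleQ_one: "1 *\<^sub>Q x = x"

global_interpretation rat_vector: vector_space "scaleQ :: rat \<Rightarrow> 'a \<Rightarrow> 'a::rat_vector"
  by unfold_locales (simp_all add: scaleQ_add_right scaleQ_add_left scaleQ_scaleQ scaleQ_one)

instantiation rat :: rat_vector
begin
definition scaleQ_rat :: "rat \<Rightarrow> rat \<Rightarrow> rat" where "scaleQ_rat a x = a * x"
instance by standard (simp_all add: scaleQ_rat_def algebra_simps)
end

definition add_subgroup :: "'a::ab_group_add set \<Rightarrow> bool" where
  "add_subgroup H \<longleftrightarrow> 0 \<in> H \<and> (\<forall>x\<in>H. \<forall>y\<in>H. x - y \<in> H)"

definition internal_direct_sum :: "'i set \<Rightarrow> ('i \<Rightarrow> 'a::ab_group_add set) \<Rightarrow> 'a set \<Rightarrow> bool" where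
  "internal_direct_sum I A H \<longleftrightarrow>
     (\<forall>i\<in>I. add_subgroup (A i)) \<and>
     H = add_subgroup hull (\<Union>i\<in>I. A i) \<and>
     (\<forall>i\<in>I. A i \<inter> (add_subgroup hull (\<Union>j\<in>I - {i}. A j)) = {0})"

definition cosets :: "'a::ab_group_add set \<Rightarrow> 'a set \<Rightarrow> 'a set set" where
  "cosets G H = (\<lambda>g. (\<lambda>h. g + h) ` H) ` G"

definition generates_quotient :: "'a::rat_vector set \<Rightarrow> 'a set \<Rightarrow> 'a \<Rightarrow> bool" where
  "generates_quotient G A d \<longleftrightarrow> d \<in> G \<and> (\<forall>g\<in>G. \<exists>n::int. g - of_int n *\<^sub>Q d \<in> A)"

text \<open>
  A characteristic assigns to each prime a natural number or infinity; the values of the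
  representing function at non-primes are irrelevant.
\<close>

definition char_equiv :: "(nat \<Rightarrow> enat) \<Rightarrow> (nat \<Rightarrow> enat) \<Rightarrow> bool" where
  "char_equiv \<chi> \<chi>' \<longleftrightarrow>
     finite {p. prime p \<and> \<chi> p \<noteq> \<chi>' p} \<and>
     (\<forall>p. prime p \<longrightarrow> (\<chi> p = \<infinity> \<longleftrightarrow> \<chi>' p = \<infinity>))"

lemma equivp_char_equiv: "equivp char_equiv"
proof (rule equivpI)
  show "reflp char_equiv" by (simp add: reflp_def char_equiv_def)
  show "symp char_equiv" by (auto simp: symp_def char_equiv_def eq_commute)
  show "transp char_equiv"
  proof (rule transpI)
    fix a b c assume ab: "char_equiv a b" and bc: "char_equiv b c"
    have "{p. prime p \<and> a p \<noteq> c p} \<subseteq>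
        {p. prime p \<and> a p \<noteq> b p} \<union> {p. prime p \<and> b p \<noteq> c p}" by auto
    with ab bc show "char_equiv a c"
      unfolding char_equiv_def by (metis (no_types, lifting) finite_Un finite_subset)
  qed
qed

quotient_type gtype = "nat \<Rightarrow> enat" / char_equiv
  by (rule equivp_char_equiv)

definition type_le :: "gtype \<Rightarrow> gtype \<Rightarrow> bool" where
  "type_le \<sigma> \<tau> \<longleftrightarrow> (\<exists>\<chi> \<chi>'. abs_gtype \<chi> = \<sigma> \<and> abs_gtype \<chi>' = \<tau> \<and> (\<forall>p. prime p \<longrightarrow> \<chi> p \<le> \<chi>' p))"

definition idempotent_type :: "gtype \<Rightarrow> bool" where
  "idempotent_type \<tau> \<longleftrightarrow> (\<exists>\<chi>. abs_gtype \<chi> = \<tau> \<and> (\<forall>p. prime p \<longrightarrow> \<chi> p = 0 \<or> \<chi> p = \<infinity>))"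

lift_definition P_inf :: "gtype \<Rightarrow> nat set" is "\<lambda>\<chi>. {p. prime p \<and> \<chi> p = \<infinity>}"
  by (auto simp: char_equiv_def)

definition P_zero :: "gtype \<Rightarrow> nat set" where
  "P_zero \<tau> = {p. prime p} - P_inf \<tau>"

definition is_P_number :: "nat set \<Rightarrow> int \<Rightarrow> bool" where
  "is_P_number P n \<longleftrightarrow> n \<noteq> 0 \<and> (\<forall>p. prime p \<longrightarrow> int p dvd n \<longrightarrow> p \<in> P)"

definition height :: "'a::rat_vector set \<Rightarrow> 'a \<Rightarrow> nat \<Rightarrow> enat" where
  "height H h p = Sup {enat k |k. \<exists>x\<in>H. of_nat (p ^ k) *\<^sub>Q x = h}"

definition rank_one :: "'a::rat_vector set \<Rightarrow> bool" where
  "rank_one H \<longleftrightarrow> add_subgroup H \<and> rat_vector.dim H = 1"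

text \<open>Only meaningful for rank-one groups, where it does not depend on the nonzero element chosen.\<close>

definition group_type :: "'a::rat_vector set \<Rightarrow> gtype" where
  "group_type H = abs_gtype (height H (SOME h. h \<in> H \<and> h \<noteq> 0))"

text \<open>The unital subring of the rationals of type \<open>\<tau>\<close>; it exists (uniquely) for idempotent \<open>\<tau>\<close>.\<close>

definition R_type :: "gtype \<Rightarrow> rat set" where
  "R_type \<tau> = (THE R. add_subgroup R \<and> 1 \<in> R \<and> (\<forall>x\<in>R. \<forall>y\<in>R. x * y \<in> R) \<and> group_type R = \<tau>)"

definition rank_one_decomposition :: "'a::rat_vector set \<Rightarrow> 'a set set \<Rightarrow> bool" where
  "rank_one_decomposition H F \<longleftrightarrow> (\<forall>D\<in>F. rank_one D) \<and> internal_direct_sum F (\<lambda>D. D) H"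

definition completely_decomposable :: "'a::rat_vector set \<Rightarrow> bool" where
  "completely_decomposable H \<longleftrightarrow> (\<exists>F. rank_one_decomposition H F)"

definition cd_finite_index :: "'a::rat_vector set \<Rightarrow> 'a set \<Rightarrow> bool" where
  "cd_finite_index G H \<longleftrightarrow> H \<subseteq> G \<and> completely_decomposable H \<and> finite (cosets G H)"

definition finite_rank :: "'a::rat_vector set \<Rightarrow> bool" where
  "finite_rank G \<longleftrightarrow> (\<exists>S. finite S \<and> G \<subseteq> rat_vector.span S)"

definition ACD :: "'a::rat_vector set \<Rightarrow> bool" where
  "ACD G \<longleftrightarrow> add_subgroup G \<and> finite_rank G \<and> (\<exists>H. cd_finite_index G H)"

definition Reg :: "'a::rat_vector set \<Rightarrow> 'a set" where
  "Reg G = \<Inter>{H. cd_finite_index G H \<and>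
     (\<forall>H'. cd_finite_index G H' \<longrightarrow> card (cosets G H) \<le> card (cosets G H'))}"

text \<open>
  The homogeneous components are taken with respect to one chosen decomposition of the regulator.
  For block-rigid groups they do not depend on this choice; the set of types never does.
\<close>

definition Reg_comp :: "'a::rat_vector set \<Rightarrow> gtype \<Rightarrow> 'a set" where
  "Reg_comp G \<tau> = add_subgroup hull
     (\<Union>{D \<in> (SOME F. rank_one_decomposition (Reg G) F). group_type D = \<tau>})"

definition types :: "'a::rat_vector set \<Rightarrow> gtype set" where
  "types G = {\<tau>. Reg_comp G \<tau> \<noteq> {0}}"

definition block_rigid :: "'a::rat_vector set \<Rightarrow> bool" where
  "block_rigid G \<longleftrightarrow> ACD G \<and>
     (\<forall>\<sigma>\<in>types G. \<forall>\<tau>\<in>types G. \<sigma> \<noteq> \<tau> \<longrightarrow> \<not> type_le \<sigma> \<tau> \<and> \<not> type_le \<tau> \<sigma>)"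

definition rigid :: "'a::rat_vector set \<Rightarrow> bool" where
  "rigid G \<longleftrightarrow> block_rigid G \<and> (\<forall>\<tau>\<in>types G. rank_one (Reg_comp G \<tau>))"

definition ring_type :: "'a::rat_vector set \<Rightarrow> bool" where
  "ring_type G \<longleftrightarrow> (\<forall>\<tau>\<in>types G. idempotent_type \<tau>)"

definition cyclic_regulator_quotient :: "'a::rat_vector set \<Rightarrow> bool" where
  "cyclic_regulator_quotient G \<longleftrightarrow> (\<exists>d. generates_quotient G (Reg G) d)"

definition class_A0 :: "'a::rat_vector set \<Rightarrow> bool" where
  "class_A0 G \<longleftrightarrow> block_rigid G \<and> ring_type G \<and> cyclic_regulator_quotient G"

definition type_proj :: "'a::rat_vector set \<Rightarrow> gtype \<Rightarrow> 'a \<Rightarrow> 'a" where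
  "type_proj G \<tau> v = (THE x. x \<in> rat_vector.span (Reg_comp G \<tau>) \<and>
     v - x \<in> rat_vector.span (\<Union>\<sigma>\<in>types G - {\<tau>}. Reg_comp G \<sigma>))"

text \<open>
  The order of the coset of the \<open>\<tau>\<close>-component of a generator \<open>d\<close> modulo the regulator, for an
  arbitrarily chosen \<open>d\<close>; the order does not depend on this choice.
\<close>

definition m_inv :: "'a::rat_vector set \<Rightarrow> gtype \<Rightarrow> nat" where
  "m_inv G \<tau> = (LEAST n. 0 < n \<and>
     of_nat n *\<^sub>Q type_proj G \<tau> (SOME d. generates_quotient G (Reg G) d) \<in> Reg G)"

definition types0 :: "'a::rat_vector set \<Rightarrow> gtype set" where
  "types0 G = {\<tau> \<in> types G. 1 < m_inv G \<tau>}"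

definition main_decomposition :: "'a::rat_vector set \<Rightarrow> 'a set \<Rightarrow> 'a set \<Rightarrow> bool" where
  "main_decomposition G G1 C \<longleftrightarrow>
     G = {x + y |x y. x \<in> G1 \<and> y \<in> C} \<and> G1 \<inter> C = {0} \<and>
     completely_decomposable C \<and> block_rigid C \<and>
     rigid G1 \<and> cyclic_regulator_quotient G1 \<and>
     types G1 = types0 G \<and> (\<forall>\<tau>\<in>types0 G. m_inv G1 \<tau> = m_inv G \<tau>)"

definition R_multiples :: "gtype \<Rightarrow> 'a::rat_vector \<Rightarrow> 'a set" where
  "R_multiples \<tau> v = (\<lambda>r. r *\<^sub>Q v) ` R_type \<tau>"

text \<open>\<open>rc_basis_via G G1 e d s\<close>: the system \<open>e\<close> (only its values on \<open>types0 G\<close> matter) is an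
  rc-basis of \<open>G\<close>, as witnessed by the generator \<open>d\<close> and the numerators \<open>s\<close>.\<close>

definition rc_basis_via ::
  "'a::rat_vector set \<Rightarrow> 'a set \<Rightarrow> (gtype \<Rightarrow> 'a) \<Rightarrow> 'a \<Rightarrow> (gtype \<Rightarrow> int) \<Rightarrow> bool" where
  "rc_basis_via G G1 e d s \<longleftrightarrow>
     (\<forall>\<tau>\<in>types0 G. e \<tau> \<in> Reg_comp G1 \<tau>) \<and>
     internal_direct_sum (types0 G) (\<lambda>\<tau>. R_multiples \<tau> (e \<tau>)) (Reg G1) \<and>
     d \<in> G1 \<and> generates_quotient G (Reg G) d \<and>
     d = (\<Sum>\<tau>\<in>types0 G. (of_int (s \<tau>) / of_nat (m_inv G \<tau>)) *\<^sub>Q e \<tau>) \<and>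
     (\<forall>\<tau>\<in>types0 G. is_P_number (P_zero \<tau>) (s \<tau>) \<and> is_P_number (P_zero \<tau>) (int (m_inv G \<tau>)) \<and>
        coprime (s \<tau>) (int (m_inv G \<tau>)))"

definition r_basis_extending ::
  "'a::rat_vector set \<Rightarrow> (gtype \<Rightarrow> 'a) \<Rightarrow> (gtype \<Rightarrow> 'a) \<Rightarrow> bool" where
  "r_basis_extending G e0 e \<longleftrightarrow>
     (\<forall>\<tau>\<in>types0 G. e \<tau> = e0 \<tau>) \<and>
     (\<forall>\<tau>\<in>types G. e \<tau> \<in> Reg_comp G \<tau>) \<and>
     internal_direct_sum (types G) (\<lambda>\<tau>. R_multiples \<tau> (e \<tau>)) (Reg G)"

text \<open>
  Elements of products indexed by \<open>types G\<close> are functions on all types that vanish outside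
  \<open>types G\<close>, with pointwise operations.
\<close>

definition M_sq :: "'a::rat_vector set \<Rightarrow> (gtype \<Rightarrow> 'a) \<Rightarrow> (gtype \<Rightarrow> 'a) set" where
  "M_sq G e = {U. (\<forall>\<tau>\<in>types G. \<exists>r\<in>R_type \<tau>. U \<tau> = ((of_nat (m_inv G \<tau>))\<^sup>2 * r) *\<^sub>Q e \<tau>) \<and>
     (\<forall>\<tau>. \<tau> \<notin> types G \<longrightarrow> U \<tau> = 0)}"

text \<open>The argument \<open>s'\<close> holds the integers inverse to the numerators \<open>s\<close> modulo \<open>m_inv G\<close>.\<close>

definition M_group :: "'a::rat_vector set \<Rightarrow> (gtype \<Rightarrow> 'a) \<Rightarrow> (gtype \<Rightarrow> int) \<Rightarrow> (gtype \<Rightarrow> 'a) set" where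
  "M_group G e s' = add_subgroup hull
     (insert (\<lambda>\<tau>. if \<tau> \<in> types0 G then (of_nat (m_inv G \<tau>) * of_int (s' \<tau>)) *\<^sub>Q e \<tau> else 0)
        (M_sq G e))"

definition K_ring :: "'a::rat_vector set \<Rightarrow> (gtype \<Rightarrow> rat) set" where
  "K_ring G = {\<lambda>\<tau>. of_int n * of_bool (\<tau> \<in> types0 G) +
       (if \<tau> \<in> types G then of_nat (m_inv G \<tau>) * r \<tau> else 0) |n r. \<forall>\<tau>\<in>types G. r \<tau> \<in> R_type \<tau>}"

definition K_units :: "'a::rat_vector set \<Rightarrow> (gtype \<Rightarrow> rat) set" where
  "K_units G = {c \<in> K_ring G. \<exists>c'\<in>K_ring G. c * c' = (\<lambda>\<tau>. of_bool (\<tau> \<in> types G))}"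

text \<open>A homomorphism from the tensor square of \<open>G\<close> to \<open>G\<close> is given as a biadditive map.\<close>

definition multiplication_on :: "'a::ab_group_add set \<Rightarrow> ('a \<Rightarrow> 'a \<Rightarrow> 'a) \<Rightarrow> bool" where
  "multiplication_on G f \<longleftrightarrow>
     (\<forall>x\<in>G. \<forall>y\<in>G. f x y \<in> G) \<and>
     (\<forall>x\<in>G. \<forall>y\<in>G. \<forall>z\<in>G. f (x + y) z = f x z + f y z \<and> f z (x + y) = f z x + f z y)"

definition determines_ring ::
  "'a::rat_vector set \<Rightarrow> (gtype \<Rightarrow> 'a) \<Rightarrow> (gtype \<Rightarrow> 'a) \<Rightarrow> ('a \<Rightarrow> 'a \<Rightarrow> 'a) \<Rightarrow> bool" where
  "determines_ring G e U f \<longleftrightarrow> multiplication_on G f \<and> (\<forall>\<tau>\<in>types G. f (e \<tau>) (e \<tau>) = U \<tau>)"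

definition rings_isomorphic ::
  "'a::ab_group_add set \<Rightarrow> ('a \<Rightarrow> 'a \<Rightarrow> 'a) \<Rightarrow> ('a \<Rightarrow> 'a \<Rightarrow> 'a) \<Rightarrow> bool" where
  "rings_isomorphic G f g \<longleftrightarrow> (\<exists>\<phi>. bij_betw \<phi> G G \<and>
     (\<forall>x\<in>G. \<forall>y\<in>G. \<phi> (x + y) = \<phi> x + \<phi> y \<and> \<phi> (f x y) = g (\<phi> x) (\<phi> y)))"

end

theory Submission imports Defs begin

text \<open>
  Every additive endomorphism of \<open>G\<close> is diagonal in the basis \<open>e\<close>, because the image of \<open>e \<tau>\<close> is
  divisible by the powers of all primes in \<open>P_inf \<tau>\<close> and the types are incomparable; its diagonal
  entries form an element of \<open>K_G\<close>, and every element of \<open>K_G\<close> arises in this way. Applied to the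
  left and right multiplications of a ring on \<open>G\<close>, this shows that the products of distinct basis
  elements vanish, so that the ring is determined by the squares of the basis elements. An
  isomorphism is thus multiplication by some \<open>c \<in> K_G\<^sup>*\<close>, and compatibility with the products on the
  \<open>e \<tau>\<close> reads \<open>c U\<^sub>* = c\<^sup>2 U\<^sub>\<times>\<close>.
\<close>

section \<open>Localizations of the integers and idempotent types\<close>

text \<open>The shape of \<open>K_G\<close> comes from the one generator \<open>d\<close> of
  \<open>G\<close> modulo the regulator. An endomorphism must send \<open>d\<close> to some
  \<open>n d\<close> plus an element of the regulator; comparing coordinates, where \<open>d\<close>
  has the denominators \<open>m_inv G \<tau>\<close>, forces all diagonal entries on
  \<open>types0 G\<close> to be congruent to the same integer \<open>n\<close> modulo these
  denominators. An idempotent type has a representative with values 0 and \<infinity> only, so it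
  amounts to a set of primes, and the algebra takes place over a rational basis with one set of
  primes per basis vector. The obstacle is to reach this setting from definitions that rest on
  \<open>SOME\<close>, \<open>THE\<close> and \<open>LEAST\<close>, and from a direct sum that does
  not by itself exclude zero summands: that every \<open>e \<tau>\<close> is nonzero and every
  \<open>m_inv G \<tau>\<close> is positive has to be proved first.\<close>

text \<open>Any \<open>P\<close>-number may serve as denominator, not only the reduced one, so
  closure under sums and products just multiplies two denominators.\<close>

definition loc :: "nat set \<Rightarrow> rat set" where
  "loc P = {x. \<exists>b. is_P_number P b \<and> of_int b * x \<in> \<int>}"

lemma locI: "is_P_number P b \<Longrightarrow> of_int b * x \<in> \<int> \<Longrightarrow> x \<in> loc P"
  unfolding loc_def by blast

lemma is_P_number_mult: "is_P_number P (a * b) \<longleftrightarrow> is_P_number P a \<and> is_P_number P b"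
  by (auto simp: is_P_number_def prime_dvd_mult_iff)

lemma is_P_number_1 [simp]: "is_P_number P 1"
  by (auto simp: is_P_number_def)

lemma is_P_number_prime_power:
  assumes "prime p" "p \<in> P"
  shows "is_P_number P (int p ^ k)"
proof -
  have "p' = p" if "prime p'" "int p' dvd int p ^ k" for p'
    using that assms by (metis prime_dvd_power_int primes_dvd_imp_eq prime_nat_int_transfer int_dvd_int_iff)
  then show ?thesis using assms by (auto simp: is_P_number_def)
qed

lemma coprime_is_P_number:
  assumes "is_P_number P b" "prime p" "p \<notin> P"
  shows "coprime (int p ^ k) b"
  using assms by (auto simp: is_P_number_def intro!: prime_imp_coprime)

lemma Ints_loc: "x \<in> \<int> \<Longrightarrow> x \<in> loc P"
  unfolding loc_def by (auto intro!: exI[of _ 1])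

lemma loc_of_int [simp]: "of_int n \<in> loc P"
  and loc_of_nat [simp]: "of_nat k \<in> loc P"
  and loc_0 [simp]: "0 \<in> loc P" and loc_1 [simp]: "1 \<in> loc P"
  by (auto intro: Ints_loc)

lemma loc_mult: assumes "x \<in> loc P" "y \<in> loc P" shows "x * y \<in> loc P"
proof -
  obtain b c where b: "is_P_number P b" "of_int b * x \<in> \<int>" and c: "is_P_number P c" "of_int c * y \<in> \<int>"
    using assms by (auto simp: loc_def)
  have "of_int (b * c) * (x * y) = (of_int b * x) * (of_int c * y)" by simp
  also have "\<dots> \<in> \<int>" using b c Ints_mult by blast
  finally show ?thesis using b c is_P_number_mult locI by metis
qed

lemma loc_minus: "x \<in> loc P \<Longrightarrow> - x \<in> loc P"
  using loc_mult[of "-1" P x] loc_of_int[of "-1" P] by simp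

lemma loc_add: assumes "x \<in> loc P" "y \<in> loc P" shows "x + y \<in> loc P"
proof -
  obtain b c where b: "is_P_number P b" "of_int b * x \<in> \<int>" and c: "is_P_number P c" "of_int c * y \<in> \<int>"
    using assms by (auto simp: loc_def)
  have "of_int (b * c) * (x + y) = of_int c * (of_int b * x) + of_int b * (of_int c * y)"
    by (simp add: algebra_simps)
  also have "\<dots> \<in> \<int>" using Ints_mult[OF Ints_of_int b(2)] Ints_mult[OF Ints_of_int c(2)] by (intro Ints_add)
  finally show ?thesis using b c is_P_number_mult locI by metis
qed

lemma loc_diff: "x \<in> loc P \<Longrightarrow> y \<in> loc P \<Longrightarrow> x - y \<in> loc P"
  using loc_add[of x P "- y"] loc_minus by simp

lemma loc_inverse_prime_power:
  assumes "prime p" "p \<in> P"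
  shows "1 / of_nat p ^ k \<in> loc P"
proof -
  have "p \<noteq> 0" using assms by auto
  then have "of_int (int p ^ k) * (1 / of_nat p ^ k :: rat) = 1" by simp
  then show ?thesis
    using is_P_number_prime_power[OF assms] by (metis Ints_1 locI)
qed

text \<open>A valuation test without valuations: a prime outside \<open>P\<close> cannot divide a
  \<open>P\<close>-number denominator, so its powers in \<open>b\<close> have to cancel against
  \<open>a\<close>. The fraction need not be reduced.\<close>

lemma loc_Fract_prime_power_dvd:
  assumes "of_int a / of_int b \<in> loc P" "prime p" "p \<notin> P" "int p ^ k dvd b" "b \<noteq> 0"
  shows "int p ^ k dvd a"
proof -
  obtain c where c: "is_P_number P c" "of_int c * (of_int a / of_int b :: rat) \<in> \<int>"
    using assms(1) by (auto simp: loc_def)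
  then obtain z where z: "of_int c * (of_int a / of_int b :: rat) = of_int z"
    by (auto elim: Ints_cases)
  then have "of_int (c * a) = (of_int (z * b) :: rat)"
    using assms(5) by (simp add: field_simps)
  then have "c * a = z * b" by (simp only: of_int_eq_iff)
  then have "int p ^ k dvd c * a" using assms(4) by simp
  then show ?thesis
    using coprime_is_P_number[OF c(1) assms(2,3), of k] by (simp add: coprime_dvd_mult_right_iff)
qed

lemma power_dvd_all_imp_zero:
  fixes a :: int
  assumes "prime p" "\<And>k. int p ^ k dvd a"
  shows "a = 0"
proof (rule ccontr)
  assume "a \<noteq> 0"
  have "int p ^ k > int k" for k
    using assms(1) prime_gt_1_nat[of p] by (simp add: less_exp power_gt_expt flip: of_nat_power)
  from this[of "nat \<bar>a\<bar>"] have "int p ^ nat \<bar>a\<bar> > \<bar>a\<bar>" by simp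
  moreover have "int p ^ nat \<bar>a\<bar> \<le> \<bar>a\<bar>"
    using dvd_imp_le_int[OF \<open>a \<noteq> 0\<close> assms(2)[of "nat \<bar>a\<bar>"]] by simp
  ultimately show False by simp
qed

lemma rat_obtain:
  fixes x :: rat
  obtains a b :: int where "x = of_int a / of_int b" "b > 0" "coprime a b"
  by (metis Fract_of_int_quotient Rat_cases)

text \<open>All powers of \<open>p\<close> would divide the numerator of \<open>x\<close>. This is
  the arithmetic source of every vanishing coordinate below.\<close>

lemma loc_divisible_imp_zero:
  assumes "prime p" "p \<notin> P" "\<And>k. x / of_nat p ^ k \<in> loc P"
  shows "x = 0"
proof -
  obtain a b where x: "x = of_int a / of_int b" "b > 0" by (rule rat_obtain)
  have "int p ^ k dvd a" for k
  proof (rule loc_Fract_prime_power_dvd[OF _ assms(1,2), of _ "b * int p ^ k"])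
    show "of_int a / of_int (b * int p ^ k) \<in> loc P"
      using assms(3)[of k] by (simp add: x)
    show "b * int p ^ k \<noteq> 0" using x assms(1) by auto
  qed auto
  then show ?thesis using x power_dvd_all_imp_zero[OF assms(1)] by simp
qed

text \<open>If a prime outside \<open>P\<close> divided the denominator of \<open>x\<close>, its
  exponent in the denominator of \<open>x ^ k\<close> would grow with \<open>k\<close>, while
  \<open>N\<close> can cancel only a fixed power. In other words, \<open>loc P\<close> is completely
  integrally closed.\<close>

lemma loc_if_powers_bounded:
  assumes "N \<noteq> 0" "\<And>k. of_int N * x ^ k \<in> loc P"
  shows "x \<in> loc P"
proof -
  obtain a b where x: "x = of_int a / of_int b" "b > 0" and cop: "coprime a b" by (rule rat_obtain)
  have "p \<in> P" if p: "prime p" "int p dvd b" for p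
  proof (rule ccontr)
    assume "p \<notin> P"
    have "int p ^ k dvd N" for k
    proof -
      have "int p ^ k dvd N * a ^ k"
      proof (rule loc_Fract_prime_power_dvd[OF _ p(1) \<open>p \<notin> P\<close>, of _ "b ^ k"])
        show "of_int (N * a ^ k) / of_int (b ^ k) \<in> loc P"
          using assms(2)[of k] by (simp add: x power_divide)
        show "int p ^ k dvd b ^ k" using p(2) by (rule dvd_power_same)
      qed (use x in auto)
      moreover have "coprime (int p ^ k) (a ^ k)"
        using coprime_divisors[OF p(2) dvd_refl] cop by (simp add: coprime_commute)
      ultimately show ?thesis by (simp add: coprime_dvd_mult_left_iff)
    qed
    then show False using power_dvd_all_imp_zero[OF p(1)] assms(1) by blast
  qed
  then have "is_P_number P b" using x by (auto simp: is_P_number_def)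
  moreover have "of_int b * x = of_int a" using x by simp
  ultimately show ?thesis by (metis Ints_of_int locI)
qed

section \<open>Additive subgroups and heights\<close>

lemma add_subgroup_0: "add_subgroup H \<Longrightarrow> 0 \<in> H"
  and add_subgroup_diff: "add_subgroup H \<Longrightarrow> x \<in> H \<Longrightarrow> y \<in> H \<Longrightarrow> x - y \<in> H"
  by (auto simp: add_subgroup_def)

lemma add_subgroup_minus: "add_subgroup H \<Longrightarrow> x \<in> H \<Longrightarrow> - x \<in> H"
  using add_subgroup_diff[of H 0 x] by (simp add: add_subgroup_0)

lemma add_subgroup_add: "add_subgroup H \<Longrightarrow> x \<in> H \<Longrightarrow> y \<in> H \<Longrightarrow> x + y \<in> H"
  using add_subgroup_diff[of H x "- y"] add_subgroup_minus[of H y] by simp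

lemma add_subgroup_sum:
  "add_subgroup H \<Longrightarrow> (\<And>i. i \<in> I \<Longrightarrow> f i \<in> H) \<Longrightarrow> sum f I \<in> H"
  by (induction I rule: infinite_finite_induct) (auto simp: add_subgroup_0 add_subgroup_add)

lemma add_subgroup_of_nat:
  "add_subgroup H \<Longrightarrow> x \<in> H \<Longrightarrow> of_nat n *\<^sub>Q x \<in> H"
  by (induction n) (auto simp: add_subgroup_0 add_subgroup_add scaleQ_add_left scaleQ_one)

lemma add_subgroup_of_int:
  assumes "add_subgroup H" "x \<in> H"
  shows "of_int n *\<^sub>Q x \<in> H"
proof (cases n rule: int_cases2)
  case (nonneg k)
  then show ?thesis using add_subgroup_of_nat[OF assms] by simp
next
  case (nonpos k)
  then show ?thesis
    using add_subgroup_minus[OF assms(1) add_subgroup_of_nat[OF assms]] by simp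
qed

lemma add_subgroup_hull: "add_subgroup (add_subgroup hull S)"
  unfolding hull_def add_subgroup_def by auto

lemma add_subgroup_loc: "add_subgroup (loc P)"
  by (simp add: add_subgroup_def loc_diff)

text \<open>The exponents \<open>k\<close> for which \<open>h\<close> is divisible by
  \<open>p ^ k\<close> in \<open>H\<close> form an initial segment, so a single missing exponent
  bounds the supremum.\<close>

lemma height_eq_infinity_iff:
  assumes "add_subgroup H"
  shows "height H h p = \<infinity> \<longleftrightarrow> (\<forall>k. \<exists>x\<in>H. of_nat (p ^ k) *\<^sub>Q x = h)"
proof
  assume inf: "height H h p = \<infinity>"
  show "\<forall>k. \<exists>x\<in>H. of_nat (p ^ k) *\<^sub>Q x = h"
  proof (rule ccontr)
    assume "\<not> ?thesis"
    then obtain k where k: "\<And>x. x \<in> H \<Longrightarrow> of_nat (p ^ k) *\<^sub>Q x \<noteq> h" by blast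
    have "j \<le> k" if x: "x \<in> H" "of_nat (p ^ j) *\<^sub>Q x = h" for j x
    proof (rule ccontr)
      assume "\<not> j \<le> k"
      then have "p ^ j = p ^ k * p ^ (j - k)" by (simp flip: power_add)
      then have "of_nat (p ^ k) *\<^sub>Q (of_nat (p ^ (j - k)) *\<^sub>Q x) = h"
        using x by (simp add: scaleQ_scaleQ)
      then show False using k add_subgroup_of_nat[OF assms x(1)] by blast
    qed
    then have "height H h p \<le> enat k"
      unfolding height_def by (intro Sup_least) auto
    then show False using inf by simp
  qed
next
  assume "\<forall>k. \<exists>x\<in>H. of_nat (p ^ k) *\<^sub>Q x = h"
  then have "{enat k |k. \<exists>x\<in>H. of_nat (p ^ k) *\<^sub>Q x = h} = range enat" by auto
  moreover have "enat k \<le> Sup (range enat)" for k by (rule Sup_upper) simp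
  ultimately show "height H h p = \<infinity>"
    unfolding height_def by (metis enat_ord_simps(1) Suc_n_not_le_n not_infinity_eq)
qed

lemma height_neq_0D:
  assumes "height H h p \<noteq> 0"
  shows "\<exists>k>0. \<exists>x\<in>H. of_nat (p ^ k) *\<^sub>Q x = h"
proof (rule ccontr)
  assume "\<not> ?thesis"
  then have "height H h p \<le> 0"
    unfolding height_def by (intro Sup_least) (auto simp: zero_enat_def)
  then show False using assms by simp
qed

text \<open>In a unital subring the places of infinite height do not depend on the nonzero element,
  so the choice of \<open>h\<close> made inside \<open>group_type\<close> does no harm.\<close>

lemma height_subring_eq_infinity_iff:
  fixes R :: "rat set"
  assumes R: "add_subgroup R" "1 \<in> R" "\<And>x y. x \<in> R \<Longrightarrow> y \<in> R \<Longrightarrow> x * y \<in> R"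
    and "h \<in> R" "h \<noteq> 0" "prime p"
  shows "height R h p = \<infinity> \<longleftrightarrow> 1 / of_nat p \<in> R"
proof -
  have p0: "p > 0" using assms(6) prime_gt_0_nat by blast
  have intR: "of_int n * x \<in> R" if "x \<in> R" for n x
    using add_subgroup_of_int[OF R(1) that, of n] by (simp add: scaleQ_rat_def)
  show ?thesis
    unfolding height_eq_infinity_iff[OF R(1)]
  proof
    assume "1 / of_nat p \<in> R"
    then have "(1 / of_nat p) ^ k \<in> R" for k
      by (induction k) (use R(2) in simp, unfold power_Suc, rule R(3))
    then have "h * (1 / of_nat p) ^ k \<in> R" for k using R(3) assms(4) by blast
    moreover have "of_nat (p ^ k) *\<^sub>Q (h * (1 / of_nat p) ^ k) = h" for k
      using p0 by (simp add: scaleQ_rat_def power_divide)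
    ultimately show "\<forall>k. \<exists>x\<in>R. of_nat (p ^ k) *\<^sub>Q x = h" by blast
  next
    assume div: "\<forall>k. \<exists>x\<in>R. of_nat (p ^ k) *\<^sub>Q x = h"
    obtain a b where h: "h = of_int a / of_int b" "b > 0" by (rule rat_obtain)
    then have "a \<noteq> 0" using assms(5) by auto
    have "\<not> is_unit (int p)" using assms(6) prime_gt_1_nat[of p] by simp
    then obtain a' where a': "a = int p ^ multiplicity (int p) a * a'" "\<not> int p dvd a'"
      using multiplicity_decompose'[OF \<open>a \<noteq> 0\<close>] by metis
    \<comment> \<open>Dividing \<open>h\<close> by one more power of \<open>p\<close> than its
      numerator contains leaves \<open>a' / p\<close> in \<open>R\<close> with \<open>a'\<close>
      prime to \<open>p\<close>; Bezout turns this into \<open>1 / p\<close>.\<close>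
    define j where "j = multiplicity (int p) a"
    obtain x where x: "x \<in> R" "of_nat (p ^ Suc j) * x = h"
      using div[rule_format, of "Suc j"] by (auto simp: scaleQ_rat_def)
    have "of_int b * x = of_int b * (of_nat (p ^ Suc j) * x) / of_nat (p ^ Suc j)"
      using p0 by simp
    also have "\<dots> = of_int a / of_nat (p ^ Suc j)"
      unfolding x h using h(2) by simp
    also have "\<dots> = of_int a' / of_nat p"
      using p0 by (subst a'(1)) (simp add: j_def)
    finally have 1: "of_int a' / of_nat p \<in> R" using intR x(1) by metis
    have "coprime (int p) a'" using a'(2) assms(6) by (simp add: prime_imp_coprime)
    then obtain u v where "u * a' + v * int p = 1"
      using bezout_int[of a' "int p"] by (auto simp: coprime_commute)
    then have "of_int u * of_int a' + of_int v * of_nat p = (1::rat)"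
      by (metis of_int_1 of_int_add of_int_mult of_int_of_nat_eq)
    then have "1 / of_nat p = of_int u * (of_int a' / of_nat p) + of_int v * (1::rat)"
      using p0 by (simp add: field_simps)
    then show "1 / of_nat p \<in> R"
      using add_subgroup_add[OF R(1) intR[OF 1] intR[OF R(2)]] by metis
  qed
qed

section \<open>Recovering a unital subring of the rationals from its type\<close>

lemma P_inf_abs: "P_inf (abs_gtype \<chi>) = {p. prime p \<and> \<chi> p = \<infinity>}"
  by (rule P_inf.abs_eq)

lemma P_inf_prime: "p \<in> P_inf \<tau> \<Longrightarrow> prime p"
  by transfer auto

text \<open>If a reduced fraction \<open>a / b\<close> lies in \<open>R\<close>, Bezout puts
  \<open>1 / b\<close> into \<open>R\<close>, and with it \<open>1 / p\<close> for every prime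
  \<open>p\<close> dividing \<open>b\<close>. Conversely \<open>1 / b\<close> is a product of such
  inverses. Hence a subring is determined by its type, which is the uniqueness behind
  \<open>R_type\<close>.\<close>

lemma subring_eq_loc:
  fixes R :: "rat set"
  assumes R: "add_subgroup R" "1 \<in> R" "\<And>x y. x \<in> R \<Longrightarrow> y \<in> R \<Longrightarrow> x * y \<in> R"
  shows "R = loc (P_inf (group_type R))"
proof -
  have intR: "of_int n * x \<in> R" if "x \<in> R" for n x
    using add_subgroup_of_int[OF R(1) that, of n] by (simp add: scaleQ_rat_def)
  define h where "h = (SOME h. h \<in> R \<and> h \<noteq> 0)"
  have h: "h \<in> R" "h \<noteq> 0"
    unfolding atomize_conj h_def by (rule someI[of _ 1]) (use R in auto)
  have P: "p \<in> P_inf (group_type R) \<longleftrightarrow> prime p \<and> 1 / of_nat p \<in> R" for p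
    using height_subring_eq_infinity_iff[OF R h] by (auto simp: group_type_def P_inf_abs h_def)
  have "x \<in> loc (P_inf (group_type R))" if x: "x \<in> R" for x
  proof -
    obtain a b where ab: "x = of_int a / of_int b" "b > 0" "coprime a b" by (rule rat_obtain)
    obtain u v where "u * a + v * b = 1" using bezout_int[of a b] ab(3) by auto
    then have "of_int u * of_int a + of_int v * of_int b = (1::rat)"
      by (metis of_int_1 of_int_add of_int_mult)
    then have "1 / of_int b = of_int u * x + of_int v * 1"
      using ab(2) by (simp add: ab(1) field_simps)
    then have b: "1 / of_int b \<in> R" using add_subgroup_add[OF R(1) intR intR] x R(2) by metis
    have "1 / of_nat p \<in> R" if "int p dvd b" for p
    proof -
      obtain q where "b = int p * q" using \<open>int p dvd b\<close> by blast
      then have "1 / of_nat p = of_int q * (1 / of_int b :: rat)" using ab(2) by auto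
      then show ?thesis using intR[OF b] by metis
    qed
    then have "is_P_number (P_inf (group_type R)) b"
      using ab(2) by (auto simp: is_P_number_def P)
    moreover have "of_int b * x = of_int a" using ab by simp
    ultimately show ?thesis by (metis Ints_of_int locI)
  qed
  moreover have "x \<in> R" if x: "x \<in> loc (P_inf (group_type R))" for x
  proof -
    obtain b where b: "is_P_number (P_inf (group_type R)) b" "of_int b * x \<in> \<int>"
      using x by (auto simp: loc_def)
    have "1 / of_int b \<in> R" using b(1)
    proof (induction b rule: prime_divisors_induct)
      case (unit b)
      then have "b = 1 \<or> b = - 1" by auto
      then show ?case using R(2) add_subgroup_minus[OF R(1,2)] by auto
    next
      case (factor p b)
      then obtain p' where p': "p = int p'" by (metis nonneg_int_cases prime_ge_0_int)
      then have "1 / of_nat p' \<in> R"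
        using factor P[of p'] by (auto simp: is_P_number_def)
      moreover have "1 / of_int b \<in> R" using factor is_P_number_mult by blast
      ultimately show ?case using R(3) p' by fastforce
    qed (simp add: is_P_number_def)
    moreover obtain z where z: "of_int b * x = of_int z" using b(2) by (auto elim: Ints_cases)
    moreover have "b \<noteq> 0" using b(1) by (auto simp: is_P_number_def)
    then have "x = of_int z * (1 / of_int b)" using z by (simp add: field_simps)
    ultimately show ?thesis using intR by metis
  qed
  ultimately show ?thesis by blast
qed

text \<open>The existence behind \<open>R_type\<close>. The heights have the right infinite places,
  and where \<chi> is 0 the height of \<open>h\<close> can be nonzero only at prime divisors of the
  numerator of \<open>h\<close>, which are finitely many; equivalence of characteristics ignores
  these.\<close>

lemma group_type_loc:
  assumes "idempotent_type \<tau>"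
  shows "group_type (loc (P_inf \<tau>)) = \<tau>"
proof -
  obtain \<chi> where \<chi>: "abs_gtype \<chi> = \<tau>" "\<And>p. prime p \<Longrightarrow> \<chi> p = 0 \<or> \<chi> p = \<infinity>"
    using assms by (auto simp: idempotent_type_def)
  define R where "R = loc (P_inf \<tau>)"
  define h where "h = (SOME h. h \<in> R \<and> h \<noteq> 0)"
  have h: "h \<in> R" "h \<noteq> 0"
    unfolding atomize_conj h_def by (rule someI[of _ 1]) (simp add: R_def)
  have P: "p \<in> P_inf \<tau> \<longleftrightarrow> \<chi> p = \<infinity>" if "prime p" for p
    using that P_inf_abs[of \<chi>] \<chi>(1) by auto
  have inf: "height R h p = \<infinity> \<longleftrightarrow> \<chi> p = \<infinity>" if p: "prime p" for p
  proof -
    have "height R h p = \<infinity> \<longleftrightarrow> 1 / of_nat p \<in> R"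
      by (rule height_subring_eq_infinity_iff[OF _ _ _ h p])
        (auto simp: R_def add_subgroup_loc loc_mult)
    also have "\<dots> \<longleftrightarrow> p \<in> P_inf \<tau>"
      using loc_inverse_prime_power[OF p, of "P_inf \<tau>" 1] p prime_gt_1_nat[OF p]
        loc_Fract_prime_power_dvd[OF _ p, of 1 "int p" "P_inf \<tau>" 1] by (auto simp: R_def)
    finally show ?thesis using P p by blast
  qed
  obtain a b where ab: "h = of_int a / of_int b" "b > 0" by (rule rat_obtain)
  have "int p dvd a" if p: "prime p" and ne: "height R h p \<noteq> \<chi> p" for p
  proof -
    have "\<chi> p = 0" "p \<notin> P_inf \<tau>" using inf[OF p] ne \<chi>(2)[OF p] P[OF p] by auto
    then obtain k x where k: "k > 0" "x \<in> R" "of_nat (p ^ k) * x = h"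
      using ne height_neq_0D[of R h p] by (auto simp: scaleQ_rat_def)
    have p0: "p > 0" using p prime_gt_0_nat by blast
    then have "x = h / of_nat (p ^ k)" using k by (auto simp: field_simps)
    then have "x = of_int a / of_int (b * int p ^ k)" by (simp add: ab)
    then have "int p ^ k dvd a"
      using loc_Fract_prime_power_dvd[OF _ p \<open>p \<notin> P_inf \<tau>\<close>, of a "b * int p ^ k" k] k(2) p0 ab(2)
      by (auto simp: R_def)
    then show ?thesis using k(1) by (meson dvd_power dvd_trans)
  qed
  then have "{p. prime p \<and> height R h p \<noteq> \<chi> p} \<subseteq> int -` {z. z dvd a}"
    by (simp add: subset_iff)
  moreover have "a \<noteq> 0" using ab h by auto
  then have "finite (int -` {z. z dvd a})"
    by (intro finite_vimageI finite_divisors_int inj_of_nat)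
  ultimately have "finite {p. prime p \<and> height R h p \<noteq> \<chi> p}"
    by (rule finite_subset)
  with inf have "char_equiv (height R h) \<chi>"
    by (simp add: char_equiv_def)
  then have "abs_gtype (height R h) = \<tau>" using \<chi>(1) gtype.abs_eq_iff by blast
  then show ?thesis unfolding group_type_def R_def h_def by simp
qed

lemma R_type_eq_loc:
  assumes "idempotent_type \<tau>"
  shows "R_type \<tau> = loc (P_inf \<tau>)"
  unfolding R_type_def
proof (rule the_equality)
  show "add_subgroup (loc (P_inf \<tau>)) \<and> 1 \<in> loc (P_inf \<tau>) \<and>
      (\<forall>x\<in>loc (P_inf \<tau>). \<forall>y\<in>loc (P_inf \<tau>). x * y \<in> loc (P_inf \<tau>)) \<and>
      group_type (loc (P_inf \<tau>)) = \<tau>"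
    using assms by (auto simp: add_subgroup_loc loc_mult group_type_loc)
qed (metis subring_eq_loc)

text \<open>For representatives with values 0 and \<infinity>, pointwise comparison is inclusion of
  the infinite places. The contrapositive turns block-rigidity into non-inclusion of sets of
  primes.\<close>

lemma type_le_if_P_inf_subset:
  assumes "idempotent_type \<sigma>" "idempotent_type \<tau>" "P_inf \<sigma> \<subseteq> P_inf \<tau>"
  shows "type_le \<sigma> \<tau>"
proof -
  obtain \<chi> where \<chi>: "abs_gtype \<chi> = \<sigma>" "\<And>p. prime p \<Longrightarrow> \<chi> p = 0 \<or> \<chi> p = \<infinity>"
    using assms(1) by (auto simp: idempotent_type_def)
  obtain \<psi> where \<psi>: "abs_gtype \<psi> = \<tau>" "\<And>p. prime p \<Longrightarrow> \<psi> p = 0 \<or> \<psi> p = \<infinity>"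
    using assms(2) by (auto simp: idempotent_type_def)
  have "\<chi> p \<le> \<psi> p" if "prime p" for p
    using assms(3) \<chi>(2)[OF that] \<psi>(2)[OF that] that P_inf_abs[of \<chi>] P_inf_abs[of \<psi>] \<chi>(1) \<psi>(1)
    by (auto simp: subset_iff)
  then show ?thesis unfolding type_le_def using \<chi>(1) \<psi>(1) by blast
qed

section \<open>Additive maps\<close>

text \<open>Additivity and directness speak about integer multiples only; this lemma reduces
  rational coefficients to that case.\<close>

lemma common_denominator:
  fixes f :: "'i \<Rightarrow> rat"
  assumes "finite I"
  shows "\<exists>N::int. N > 0 \<and> (\<forall>i\<in>I. of_int N * f i \<in> \<int>)"
  using assms
proof induction
  case (insert i I)
  then obtain N where N: "N > 0" "\<And>j. j \<in> I \<Longrightarrow> of_int N * f j \<in> \<int>" by blast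
  obtain a b where ab: "f i = of_int a / of_int b" "b > 0" by (rule rat_obtain)
  have "of_int (N * b) * f j \<in> \<int>" if "j \<in> insert i I" for j
  proof (cases "j = i")
    case True
    then have "of_int (N * b) * f j = of_int (N * a)" using ab by simp
    then show ?thesis by (metis Ints_of_int)
  next
    case False
    then have "of_int b * (of_int N * f j) \<in> \<int>" using that N(2) Ints_mult[OF Ints_of_int] by blast
    then show ?thesis by (simp add: mult_ac)
  qed
  then show ?case using N(1) ab(2) by (intro exI[of _ "N * b"]) auto
qed (auto intro: exI[of _ 1])

text \<open>Relative to \<open>G\<close>, because multiplications and isomorphisms are total
  functions with arbitrary values off \<open>G\<close>.\<close>

definition additive_on :: "'a::ab_group_add set \<Rightarrow> ('a \<Rightarrow> 'b::ab_group_add) \<Rightarrow> bool" where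
  "additive_on G \<phi> \<longleftrightarrow> (\<forall>x\<in>G. \<forall>y\<in>G. \<phi> (x + y) = \<phi> x + \<phi> y)"

context
  fixes G :: "'a::ab_group_add set" and \<phi> :: "'a \<Rightarrow> 'b::ab_group_add"
  assumes G: "add_subgroup G" and \<phi>: "additive_on G \<phi>"
begin

lemma additive_on_0: "\<phi> 0 = 0"
proof -
  have "\<phi> (0 + 0) = \<phi> 0 + \<phi> 0" using \<phi> add_subgroup_0[OF G] unfolding additive_on_def by blast
  then show ?thesis by simp
qed

lemma additive_on_minus:
  assumes "x \<in> G" shows "\<phi> (- x) = - \<phi> x"
proof -
  have "\<phi> (x + - x) = \<phi> x + \<phi> (- x)"
    using \<phi> assms add_subgroup_minus[OF G] unfolding additive_on_def by blast
  then show ?thesis using additive_on_0 by (simp add: eq_neg_iff_add_eq_0 add.commute)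
qed

lemma additive_on_sum:
  "(\<And>i. i \<in> I \<Longrightarrow> f i \<in> G) \<Longrightarrow> \<phi> (sum f I) = (\<Sum>i\<in>I. \<phi> (f i))"
proof (induction I rule: infinite_finite_induct)
  case (insert i I)
  then have "\<phi> (f i + sum f I) = \<phi> (f i) + \<phi> (sum f I)"
    using \<phi> add_subgroup_sum[OF G, of I f] unfolding additive_on_def by blast
  with insert show ?case by simp
qed (auto simp: additive_on_0)

end

lemma additive_on_of_int:
  fixes G :: "'a::rat_vector set" and \<phi> :: "'a \<Rightarrow> 'b::rat_vector"
  assumes G: "add_subgroup G" and \<phi>: "additive_on G \<phi>" and x: "x \<in> G"
  shows "\<phi> (of_int n *\<^sub>Q x) = of_int n *\<^sub>Q \<phi> x"
proof -
  have nat: "\<phi> (of_nat k *\<^sub>Q x) = of_nat k *\<^sub>Q \<phi> x" for k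
  proof (induction k)
    case (Suc k)
    have "\<phi> (x + of_nat k *\<^sub>Q x) = \<phi> x + \<phi> (of_nat k *\<^sub>Q x)"
      using \<phi> x add_subgroup_of_nat[OF G x] unfolding additive_on_def by blast
    with Suc show ?case by (simp add: scaleQ_add_left scaleQ_one)
  qed (simp add: additive_on_0[OF G \<phi>])
  show ?thesis
  proof (cases n rule: int_cases2)
    case (nonpos k)
    then show ?thesis
      using nat[of k] additive_on_minus[OF G \<phi> add_subgroup_of_nat[OF G x]] by simp
  qed (use nat in simp)
qed

section \<open>Endomorphisms and multiplications in coordinates\<close>

text \<open>Types are abstracted to indices, and \<open>P i\<close> stands for the primes at which
  the \<open>i\<close>-th type is infinite. The regulator will be \<open>lattice\<close>.\<close>

locale rational_frame =
  fixes T :: "'i set" and e :: "'i \<Rightarrow> 'a::rat_vector" and P :: "'i \<Rightarrow> nat set"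
  assumes finite_T: "finite T"
    and inj_e: "inj_on e T"
    and independent_e: "rat_vector.independent (e ` T)"
begin

definition coord :: "'i \<Rightarrow> 'a \<Rightarrow> rat" where
  "coord i x = rat_vector.representation (e ` T) x (e i)"

definition lattice :: "'a set" where
  "lattice = {x \<in> rat_vector.span (e ` T). \<forall>i\<in>T. coord i x \<in> loc (P i)}"

definition diag :: "('i \<Rightarrow> rat) \<Rightarrow> 'a \<Rightarrow> 'a" where
  "diag c x = (\<Sum>i\<in>T. (c i * coord i x) *\<^sub>Q e i)"

lemma comb_in_span: "I \<subseteq> T \<Longrightarrow> (\<Sum>i\<in>I. f i *\<^sub>Q e i) \<in> rat_vector.span (e ` I)"
  by (intro rat_vector.span_sum rat_vector.span_scale rat_vector.span_base) auto

lemma comb_in_span_T [simp]: "(\<Sum>i\<in>T. f i *\<^sub>Q e i) \<in> rat_vector.span (e ` T)"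
  by (rule comb_in_span) simp

lemma e_in_span [simp]: "i \<in> T \<Longrightarrow> e i \<in> rat_vector.span (e ` T)"
  by (intro rat_vector.span_base) auto

lemma coord_add:
  "x \<in> rat_vector.span (e ` T) \<Longrightarrow> y \<in> rat_vector.span (e ` T) \<Longrightarrow> coord i (x + y) = coord i x + coord i y"
  unfolding coord_def by (simp add: rat_vector.representation_add[OF independent_e])

lemma coord_diff:
  "x \<in> rat_vector.span (e ` T) \<Longrightarrow> y \<in> rat_vector.span (e ` T) \<Longrightarrow> coord i (x - y) = coord i x - coord i y"
  unfolding coord_def by (simp add: rat_vector.representation_diff[OF independent_e])

lemma coord_scale:
  "x \<in> rat_vector.span (e ` T) \<Longrightarrow> coord i (q *\<^sub>Q x) = q * coord i x"
  unfolding coord_def by (simp add: rat_vector.representation_scale[OF independent_e])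

lemma coord_0 [simp]: "coord i 0 = 0"
  unfolding coord_def by (simp add: rat_vector.representation_zero)

lemma coord_e: "i \<in> T \<Longrightarrow> j \<in> T \<Longrightarrow> coord j (e i) = of_bool (j = i)"
  unfolding coord_def
  using rat_vector.representation_basis[OF independent_e, of "e i"] inj_onD[OF inj_e] by auto

lemma coord_comb:
  assumes "I \<subseteq> T" "j \<in> T"
  shows "coord j (\<Sum>i\<in>I. f i *\<^sub>Q e i) = (if j \<in> I then f j else 0)"
proof -
  have "finite I" using assms(1) finite_T finite_subset by blast
  have "coord j (\<Sum>i\<in>I. f i *\<^sub>Q e i) = (\<Sum>i\<in>I. coord j (f i *\<^sub>Q e i))"
    unfolding coord_def using assms(1)
    by (subst rat_vector.representation_sum[OF independent_e])
      (auto intro: rat_vector.span_scale rat_vector.span_base)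
  also have "\<dots> = (\<Sum>i\<in>I. if j = i then f i else 0)"
    using assms by (intro sum.cong) (auto simp: coord_scale coord_e)
  finally show ?thesis using \<open>finite I\<close> by simp
qed

lemma coord_comb_T [simp]: "j \<in> T \<Longrightarrow> coord j (\<Sum>i\<in>T. f i *\<^sub>Q e i) = f j"
  by (simp add: coord_comb)

lemma expand:
  assumes "x \<in> rat_vector.span (e ` T)"
  shows "(\<Sum>i\<in>T. coord i x *\<^sub>Q e i) = x"
proof -
  have "x = (\<Sum>b\<in>e ` T. rat_vector.representation (e ` T) x b *\<^sub>Q b)"
    using rat_vector.sum_representation_eq[OF independent_e assms] finite_T by simp
  then show ?thesis by (simp add: sum.reindex[OF inj_e] coord_def)
qed

lemma coord_eqI:
  assumes "x \<in> rat_vector.span (e ` T)" "y \<in> rat_vector.span (e ` T)"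
    and "\<And>i. i \<in> T \<Longrightarrow> coord i x = coord i y"
  shows "x = y"
proof -
  have "(\<Sum>i\<in>T. coord i x *\<^sub>Q e i) = (\<Sum>i\<in>T. coord i y *\<^sub>Q e i)"
    using assms(3) by (intro sum.cong) auto
  then show ?thesis using expand assms(1,2) by simp
qed

lemma e_nonzero: "i \<in> T \<Longrightarrow> e i \<noteq> 0"
  using independent_e rat_vector.dependent_zero by (metis imageI)

text \<open>Describes the complement in the definition of \<open>type_proj\<close> by a coordinate,
  so that this projection can be evaluated.\<close>

lemma span_diff_singleton_iff:
  assumes "i \<in> T"
  shows "x \<in> rat_vector.span (e ` (T - {i})) \<longleftrightarrow> x \<in> rat_vector.span (e ` T) \<and> coord i x = 0"
proof
  assume x: "x \<in> rat_vector.span (e ` (T - {i}))"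
  have "rat_vector.subspace {y \<in> rat_vector.span (e ` T). coord i y = 0}"
    by (rule rat_vector.subspaceI)
      (auto simp: rat_vector.span_zero rat_vector.span_add rat_vector.span_scale coord_add coord_scale)
  then have "rat_vector.span (e ` (T - {i})) \<subseteq> {y \<in> rat_vector.span (e ` T). coord i y = 0}"
    using assms by (intro rat_vector.span_minimal) (auto simp: coord_e)
  then show "x \<in> rat_vector.span (e ` T) \<and> coord i x = 0" using x by blast
next
  assume x: "x \<in> rat_vector.span (e ` T) \<and> coord i x = 0"
  then have "x = (\<Sum>j\<in>T. coord j x *\<^sub>Q e j)" using expand by simp
  also have "\<dots> = (\<Sum>j\<in>T - {i}. coord j x *\<^sub>Q e j)"
    using x assms finite_T by (simp add: sum.remove)
  finally show "x \<in> rat_vector.span (e ` (T - {i}))" using comb_in_span[of "T - {i}"] by (metis Diff_subset)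
qed

lemma coord_diag [simp]: "i \<in> T \<Longrightarrow> coord i (diag c x) = c i * coord i x"
  by (simp add: diag_def)

lemma diag_in_span [simp]: "diag c x \<in> rat_vector.span (e ` T)"
  by (simp add: diag_def)

lemma lattice_subset_span: "lattice \<subseteq> rat_vector.span (e ` T)"
  by (auto simp: lattice_def)

lemma scale_e_in_lattice: "i \<in> T \<Longrightarrow> r \<in> loc (P i) \<Longrightarrow> r *\<^sub>Q e i \<in> lattice"
  by (auto simp: lattice_def coord_scale coord_e intro: rat_vector.span_scale)

lemma add_subgroup_lattice: "add_subgroup lattice"
  by (auto simp: add_subgroup_def lattice_def rat_vector.span_zero rat_vector.span_diff coord_diff loc_diff)

text \<open>Links the generated subgroup in \<open>internal_direct_sum\<close> with membership
  tested coordinate by coordinate.\<close>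

lemma lattice_eq_hull: "lattice = add_subgroup hull (\<Union>i\<in>T. (\<lambda>r. r *\<^sub>Q e i) ` loc (P i))"
proof
  show "add_subgroup hull (\<Union>i\<in>T. (\<lambda>r. r *\<^sub>Q e i) ` loc (P i)) \<subseteq> lattice"
    by (rule hull_minimal) (auto simp: scale_e_in_lattice add_subgroup_lattice)
  show "lattice \<subseteq> add_subgroup hull (\<Union>i\<in>T. (\<lambda>r. r *\<^sub>Q e i) ` loc (P i))"
  proof
    fix x assume x: "x \<in> lattice"
    have "(\<Sum>i\<in>T. coord i x *\<^sub>Q e i) \<in> add_subgroup hull (\<Union>i\<in>T. (\<lambda>r. r *\<^sub>Q e i) ` loc (P i))"
      using x by (intro add_subgroup_sum[OF add_subgroup_hull] hull_inc) (auto simp: lattice_def)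
    then show "x \<in> add_subgroup hull (\<Union>i\<in>T. (\<lambda>r. r *\<^sub>Q e i) ` loc (P i))"
      using expand x lattice_subset_span by auto
  qed
qed

end

section \<open>Extending the lattice by one generator\<close>

text \<open>\<open>G_eq\<close> says that \<open>d\<close> generates \<open>G\<close> modulo the
  lattice; incomparability of types is present as non-inclusion of the sets
  \<open>P i\<close>.\<close>

locale cyclic_extension_frame = rational_frame T e P
  for T :: "'i set" and e :: "'i \<Rightarrow> 'a::rat_vector" and P :: "'i \<Rightarrow> nat set" +
  fixes G :: "'a set" and d :: 'a and T0 :: "'i set" and s :: "'i \<Rightarrow> int" and m :: "'i \<Rightarrow> nat"
  assumes prime_P: "i \<in> T \<Longrightarrow> p \<in> P i \<Longrightarrow> prime p"
    and incomparable: "i \<in> T \<Longrightarrow> j \<in> T \<Longrightarrow> i \<noteq> j \<Longrightarrow> \<not> P i \<subseteq> P j"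
    and T0_subset: "T0 \<subseteq> T"
    and m_pos: "i \<in> T \<Longrightarrow> m i > 0"
    and m_eq_1: "i \<in> T - T0 \<Longrightarrow> m i = 1"
    and coprime_s_m: "i \<in> T0 \<Longrightarrow> coprime (s i) (int (m i))"
    and d_eq: "d = (\<Sum>i\<in>T0. (of_int (s i) / of_nat (m i)) *\<^sub>Q e i)"
    and G_eq: "G = {of_int n *\<^sub>Q d + a |n a. a \<in> lattice}"
begin

text \<open>This is \<open>K_ring\<close> up to values outside \<open>T\<close>, which are left
  arbitrary because \<open>diag\<close> never reads them.\<close>

definition mult_ring :: "('i \<Rightarrow> rat) set" where
  "mult_ring = {c. \<exists>n. \<forall>i\<in>T. \<exists>r\<in>loc (P i). c i = of_int n * of_bool (i \<in> T0) + of_nat (m i) * r}"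

lemma d_in_span [simp]: "d \<in> rat_vector.span (e ` T)"
  unfolding d_eq
  by (rule subsetD[OF rat_vector.span_mono[OF image_mono[OF T0_subset]] comb_in_span[OF T0_subset]])

lemma coord_d: "i \<in> T \<Longrightarrow> coord i d = (if i \<in> T0 then of_int (s i) / of_nat (m i) else 0)"
  unfolding d_eq by (rule coord_comb[OF T0_subset])

lemma lattice_subset_G: "lattice \<subseteq> G"
proof
  fix x assume "x \<in> lattice"
  moreover have "x = of_int 0 *\<^sub>Q d + x" by simp
  ultimately show "x \<in> G" unfolding G_eq by blast
qed

lemma G_subset_span: "G \<subseteq> rat_vector.span (e ` T)"
  unfolding G_eq using lattice_subset_span
  by (auto intro!: rat_vector.span_add rat_vector.span_scale)

lemma add_subgroup_G: "add_subgroup G"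
proof -
  have "x - y \<in> G" if "x \<in> G" "y \<in> G" for x y
  proof -
    obtain n a n' a' where "x = of_int n *\<^sub>Q d + a" "a \<in> lattice" "y = of_int n' *\<^sub>Q d + a'" "a' \<in> lattice"
      using \<open>x \<in> G\<close> \<open>y \<in> G\<close> unfolding G_eq by blast
    moreover from this have "x - y = of_int (n - n') *\<^sub>Q d + (a - a')"
      by (simp add: rat_vector.scale_left_diff_distrib)
    ultimately show ?thesis
      using add_subgroup_diff[OF add_subgroup_lattice] unfolding G_eq by blast
  qed
  moreover have "0 \<in> G" using add_subgroup_0[OF add_subgroup_lattice] lattice_subset_G by blast
  ultimately show ?thesis unfolding add_subgroup_def by blast
qed

lemma d_in_G: "d \<in> G"
proof -
  have "d = of_int 1 *\<^sub>Q d + 0" by (simp add: scaleQ_one)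
  then show ?thesis unfolding G_eq using add_subgroup_0[OF add_subgroup_lattice] by blast
qed

lemma e_in_G: "i \<in> T \<Longrightarrow> e i \<in> G"
  using scale_e_in_lattice[of i 1] lattice_subset_G by (auto simp: scaleQ_one)

text \<open>Bounded denominators: \<open>G\<close> exceeds the lattice only by multiples of
  \<open>d\<close>, whose \<open>i\<close>-th coordinate is cleared by the fixed factor
  \<open>m i\<close>.\<close>

lemma m_coord_in_loc:
  assumes "x \<in> G" "i \<in> T"
  shows "of_nat (m i) * coord i x \<in> loc (P i)"
proof -
  obtain n a where x: "x = of_int n *\<^sub>Q d + a" "a \<in> lattice" using assms(1) unfolding G_eq by blast
  then have "coord i x = of_int n * coord i d + coord i a"
    using lattice_subset_span by (auto simp: coord_add coord_scale rat_vector.span_scale)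
  then have "of_nat (m i) * coord i x
      = (if i \<in> T0 then of_int (n * s i) else 0) + of_nat (m i) * coord i a"
    using m_pos[OF assms(2)] assms(2) by (auto simp: coord_d algebra_simps)
  moreover have "coord i a \<in> loc (P i)" using x(2) assms(2) by (auto simp: lattice_def)
  moreover have "(if i \<in> T0 then of_int (n * s i) else 0) \<in> loc (P i)"
    by (simp del: of_int_mult)
  ultimately show ?thesis by (simp only: loc_add loc_mult loc_of_nat)
qed

lemma coord_eq_0_if_divisible:
  assumes "i \<in> T" "prime p" "p \<notin> P i" "\<And>k. \<exists>y\<in>G. of_nat (p ^ k) *\<^sub>Q y = x"
  shows "coord i x = 0"
proof -
  have "of_nat (m i) * coord i x / of_nat p ^ k \<in> loc (P i)" for k
  proof -
    obtain y where y: "y \<in> G" "of_nat (p ^ k) *\<^sub>Q y = x" using assms(4) by blast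
    then have "coord i x = of_nat (p ^ k) * coord i y"
      using coord_scale G_subset_span by blast
    then have "of_nat (m i) * coord i x / of_nat p ^ k = of_nat (m i) * coord i y"
      using assms(2) prime_gt_0_nat[of p] by simp
    then show ?thesis using m_coord_in_loc[OF y(1) assms(1)] by simp
  qed
  then have "of_nat (m i) * coord i x = 0"
    using loc_divisible_imp_zero assms(2,3) by blast
  then show ?thesis using m_pos[OF assms(1)] by simp
qed

text \<open>Since the \<open>P i\<close> are incomparable, divisibility forces the image of \<open>e i\<close> into the line of \<open>e i\<close>.\<close>

lemma additive_eq_diag:
  assumes \<phi>: "additive_on G \<phi>" "\<phi> ` G \<subseteq> G"
  obtains c where "\<And>x. x \<in> G \<Longrightarrow> \<phi> x = diag c x"
proof -
  define c where "c i = coord i (\<phi> (e i))" for i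
  have \<phi>_span: "\<phi> x \<in> rat_vector.span (e ` T)" if "x \<in> G" for x
    using \<phi>(2) G_subset_span that by blast
  have off: "coord j (\<phi> (e i)) = 0" if ij: "i \<in> T" "j \<in> T" "i \<noteq> j" for i j
  proof -
    obtain p where p: "p \<in> P i" "p \<notin> P j" using incomparable[OF ij] by blast
    then have "prime p" using prime_P ij(1) by blast
    show ?thesis
    proof (rule coord_eq_0_if_divisible[OF ij(2) \<open>prime p\<close> p(2)])
      fix k
      define y where "y = (1 / of_nat p ^ k) *\<^sub>Q e i"
      have "y \<in> lattice"
        unfolding y_def using loc_inverse_prime_power[OF \<open>prime p\<close> p(1)] ij(1)
        by (rule scale_e_in_lattice[rotated])
      then have y: "y \<in> G" using lattice_subset_G by blast
      have "of_nat (p ^ k) *\<^sub>Q y = e i"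
        using prime_gt_0_nat[OF \<open>prime p\<close>] by (simp add: y_def scaleQ_scaleQ scaleQ_one)
      then have "of_nat (p ^ k) *\<^sub>Q \<phi> y = \<phi> (e i)"
        using additive_on_of_int[OF add_subgroup_G \<phi>(1) y, of "int (p ^ k)"] by simp
      then show "\<exists>y\<in>G. of_nat (p ^ k) *\<^sub>Q y = \<phi> (e i)" using \<phi>(2) y by blast
    qed
  qed
  have "\<phi> x = diag c x" if x: "x \<in> G" for x
  proof (rule coord_eqI)
    fix i assume i: "i \<in> T"
    have xs: "x \<in> rat_vector.span (e ` T)" using x G_subset_span by blast
    \<comment> \<open>Additivity gives compatibility with integer multiples only, so the coordinates
      of \<open>x\<close> are made integral, \<phi> is evaluated on \<open>N x\<close>, and
      \<open>N\<close> is cancelled at the end.\<close>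
    obtain N :: int where N: "N > 0" "\<And>j. j \<in> T \<Longrightarrow> of_int N * coord j x \<in> \<int>"
      using common_denominator[OF finite_T, of "\<lambda>j. coord j x"] by blast
    then have "\<forall>j\<in>T. \<exists>n. of_int N * coord j x = of_int n" by (meson Ints_cases)
    then obtain n where n: "\<And>j. j \<in> T \<Longrightarrow> of_int N * coord j x = of_int (n j)" by metis
    have "of_int N *\<^sub>Q x = of_int N *\<^sub>Q (\<Sum>j\<in>T. coord j x *\<^sub>Q e j)" using expand[OF xs] by simp
    also have "\<dots> = (\<Sum>j\<in>T. of_int (n j) *\<^sub>Q e j)"
      using n by (simp add: rat_vector.scale_sum_right scaleQ_scaleQ)
    finally have "of_int N *\<^sub>Q \<phi> x = \<phi> (\<Sum>j\<in>T. of_int (n j) *\<^sub>Q e j)"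
      using additive_on_of_int[OF add_subgroup_G \<phi>(1) x] by metis
    also have "\<dots> = (\<Sum>j\<in>T. of_int (n j) *\<^sub>Q \<phi> (e j))"
      using e_in_G additive_on_of_int[OF add_subgroup_G \<phi>(1)] add_subgroup_of_int[OF add_subgroup_G]
      by (subst additive_on_sum[OF add_subgroup_G \<phi>(1)]) auto
    also have "\<dots> = (\<Sum>j\<in>T. (of_int (n j) * c j) *\<^sub>Q e j)"
    proof (intro sum.cong refl)
      fix j assume j: "j \<in> T"
      have "\<phi> (e j) = c j *\<^sub>Q e j"
        using j off \<phi>_span[OF e_in_G[OF j]]
        by (intro coord_eqI) (auto simp: coord_scale coord_e c_def intro: rat_vector.span_scale)
      then show "of_int (n j) *\<^sub>Q \<phi> (e j) = (of_int (n j) * c j) *\<^sub>Q e j" by (simp add: scaleQ_scaleQ)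
    qed
    finally have "of_int N * coord i (\<phi> x) = of_int (n i) * c i"
      using i coord_scale[OF \<phi>_span[OF x], of i "of_int N"] by simp
    then have "of_int N * coord i (\<phi> x) = of_int N * (c i * coord i x)"
      using n[OF i] by (simp add: mult_ac)
    then show "coord i (\<phi> x) = coord i (diag c x)" using N(1) i by simp
  qed (use \<phi>_span x in auto)
  then show thesis using that by blast
qed

text \<open>The powers of \<open>c i\<close> have bounded denominators outside \<open>P i\<close> because all iterates of
  \<open>diag c\<close> map \<open>G\<close> to itself.\<close>

lemma mult_ring_if_diag:
  assumes c: "\<And>x. x \<in> G \<Longrightarrow> diag c x \<in> G"
  shows "c \<in> mult_ring"
proof -
  have loc: "c i \<in> loc (P i)" if i: "i \<in> T" for i
  proof (rule loc_if_powers_bounded)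
    fix k
    have "(diag c ^^ k) (e i) \<in> G \<and> coord i ((diag c ^^ k) (e i)) = c i ^ k"
      by (induction k) (use i e_in_G c in \<open>auto simp: coord_e\<close>)
    then show "of_int (int (m i)) * c i ^ k \<in> loc (P i)"
      using m_coord_in_loc[of "(diag c ^^ k) (e i)" i] i by simp
  qed (use m_pos i in auto)
  \<comment> \<open>The image of the single generator \<open>d\<close> supplies one integer
    \<open>n\<close> for all indices at once.\<close>
  obtain n a where na: "diag c d = of_int n *\<^sub>Q d + a" "a \<in> lattice"
    using c[OF d_in_G] unfolding G_eq by blast
  have "\<exists>r\<in>loc (P i). c i = of_int n * of_bool (i \<in> T0) + of_nat (m i) * r" if i: "i \<in> T" for i
  proof (cases "i \<in> T0")
    case True
    have "coord i (diag c d) = of_int n * coord i d + coord i a"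
      unfolding na(1) using na(2) lattice_subset_span
      by (subst coord_add) (auto simp: coord_scale rat_vector.span_scale)
    then have a: "(c i - of_int n) * of_int (s i) = of_nat (m i) * coord i a"
      using i True m_pos[OF i] by (simp add: coord_d field_simps)
    \<comment> \<open>The equation \<open>a\<close> shows that \<open>m i\<close> divides
      \<open>(c i - n) * s i\<close> in \<open>loc (P i)\<close>; since \<open>s i\<close> is
      invertible modulo \<open>m i\<close>, it divides \<open>c i - n\<close> itself.\<close>
    obtain u v where "u * s i + v * int (m i) = 1"
      using bezout_int[of "s i" "int (m i)"] coprime_s_m[OF True] by auto
    then have uv: "of_int u * of_int (s i) + of_int v * of_nat (m i) = (1::rat)"
      by (metis of_int_1 of_int_add of_int_mult of_int_of_nat_eq)
    have "c i - of_int n = (c i - of_int n) * (of_int u * of_int (s i) + of_int v * of_nat (m i))"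
      unfolding uv by simp
    also have "\<dots> = of_int u * ((c i - of_int n) * of_int (s i)) + of_nat (m i) * (of_int v * (c i - of_int n))"
      by (simp add: algebra_simps)
    also have "\<dots> = of_nat (m i) * (of_int u * coord i a + of_int v * (c i - of_int n))"
      unfolding a by (simp add: algebra_simps)
    finally have "c i = of_int n + of_nat (m i) * (of_int u * coord i a + of_int v * (c i - of_int n))"
      by simp
    moreover have "of_int u * coord i a + of_int v * (c i - of_int n) \<in> loc (P i)"
      using na(2) i loc[OF i] by (intro loc_add loc_mult loc_diff) (auto simp: lattice_def)
    ultimately show ?thesis using True by auto
  next
    case False
    then show ?thesis using loc[OF i] m_eq_1[of i] i by auto
  qed
  then show ?thesis unfolding mult_ring_def by blast
qed

text \<open>On \<open>T0\<close> the congruence of \<open>c i\<close> to \<open>n\<close> cancels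
  the denominator \<open>m i\<close> in \<open>diag c d - n d\<close>, and off \<open>T0\<close> the
  coordinate of \<open>d\<close> is zero. Hence the difference lies in the lattice.\<close>

lemma diag_in_G:
  assumes "c \<in> mult_ring" "x \<in> G"
  shows "diag c x \<in> G"
proof -
  obtain n where "\<forall>i\<in>T. \<exists>r\<in>loc (P i). c i = of_int n * of_bool (i \<in> T0) + of_nat (m i) * r"
    using assms(1) unfolding mult_ring_def by blast
  then obtain r where r: "\<And>i. i \<in> T \<Longrightarrow> r i \<in> loc (P i)"
      "\<And>i. i \<in> T \<Longrightarrow> c i = of_int n * of_bool (i \<in> T0) + of_nat (m i) * r i" by metis
  obtain k a where x: "x = of_int k *\<^sub>Q d + a" "a \<in> lattice" using assms(2) unfolding G_eq by blast
  have as: "a \<in> rat_vector.span (e ` T)" using x(2) lattice_subset_span by blast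
  have "diag c x - of_int (n * k) *\<^sub>Q d \<in> lattice"
    unfolding lattice_def
  proof (safe intro!: rat_vector.span_diff rat_vector.span_scale diag_in_span d_in_span)
    fix i assume i: "i \<in> T"
    have "coord i (diag c x - of_int (n * k) *\<^sub>Q d)
        = c i * (of_int k * coord i d + coord i a) - of_int (n * k) * coord i d"
      using i as by (simp add: coord_diff coord_scale coord_add x(1) rat_vector.span_scale)
    also have "\<dots> = (if i \<in> T0 then r i * of_int (k * s i) else 0) + c i * coord i a"
      using i m_pos[OF i] by (simp add: r(2) coord_d field_simps)
    also have "\<dots> \<in> loc (P i)"
    proof (rule loc_add)
      have "c i \<in> loc (P i)" unfolding r(2)[OF i]
        using r(1)[OF i] by (intro loc_add loc_mult) (auto simp: of_bool_def)
      then show "c i * coord i a \<in> loc (P i)"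
        using x(2) i by (intro loc_mult) (auto simp: lattice_def)
    qed (use r(1)[OF i] loc_mult loc_of_int in auto)
    finally show "coord i (diag c x - of_int (n * k) *\<^sub>Q d) \<in> loc (P i)" .
  qed
  then have "of_int (n * k) *\<^sub>Q d + (diag c x - of_int (n * k) *\<^sub>Q d) \<in> G" unfolding G_eq by blast
  then show ?thesis by simp
qed

lemma additive_on_diag: "additive_on G (diag c)"
  unfolding additive_on_def
proof (intro ballI coord_eqI)
  fix x y i assume "x \<in> G" "y \<in> G" and i: "i \<in> T"
  then have "x \<in> rat_vector.span (e ` T)" "y \<in> rat_vector.span (e ` T)" using G_subset_span by auto
  then show "coord i (diag c (x + y)) = coord i (diag c x + diag c y)"
    using i by (simp add: coord_add distrib_left)
qed (auto intro: rat_vector.span_add)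

text \<open>Apply \<open>additive_eq_diag\<close> to the left and then to the right multiplications.\<close>

lemma multiplication_eq:
  assumes f: "multiplication_on G f" and u: "\<And>i. i \<in> T \<Longrightarrow> f (e i) (e i) = u i *\<^sub>Q e i"
    and x: "x \<in> G" and y: "y \<in> G"
  shows "f x y = (\<Sum>i\<in>T. (coord i x * coord i y * u i) *\<^sub>Q e i)"
proof -
  have fG: "f a b \<in> G" if "a \<in> G" "b \<in> G" for a b
    using f that by (auto simp: multiplication_on_def)
  have left: "additive_on G (f a)" and right: "additive_on G (\<lambda>b. f b a)" if "a \<in> G" for a
    using f that by (auto simp: multiplication_on_def additive_on_def)
  have "\<exists>c. \<forall>b\<in>G. f a b = diag c b" if "a \<in> G" for a
    by (rule additive_eq_diag[OF left[OF that]]) (use fG that in blast)+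
  then obtain L where L: "\<And>a b. a \<in> G \<Longrightarrow> b \<in> G \<Longrightarrow> f a b = diag (L a) b" by metis
  have "\<exists>c. \<forall>b\<in>G. f b a = diag c b" if "a \<in> G" for a
    by (rule additive_eq_diag[OF right[OF that]]) (use fG that in blast)+
  then obtain R where R: "\<And>a b. a \<in> G \<Longrightarrow> b \<in> G \<Longrightarrow> f b a = diag (R a) b" by metis
  show ?thesis
  proof (rule coord_eqI)
    fix i assume i: "i \<in> T"
    have "L (e i) i = u i"
    proof -
      have "diag (L (e i)) (e i) = u i *\<^sub>Q e i" using L[OF e_in_G e_in_G, of i i] u[OF i] i by simp
      then show ?thesis
        using coord_diag[OF i, of "L (e i)" "e i"] i by (simp add: coord_scale coord_e del: coord_diag)
    qed
    then have "coord i (f (e i) y) = u i * coord i y"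
      using L[OF e_in_G[OF i] y] i by simp
    \<comment> \<open>The product of \<open>e i\<close> and \<open>y\<close>, known from left
      multiplication by \<open>e i\<close>, is reread as right multiplication by \<open>y\<close>.
      This yields the diagonal entry of the latter, which then applies to every
      \<open>x\<close>.\<close>
    then have "R y i = u i * coord i y"
      using R[OF y e_in_G[OF i]] i by (simp add: coord_e)
    then show "coord i (f x y) = coord i (\<Sum>i\<in>T. (coord i x * coord i y * u i) *\<^sub>Q e i)"
      using R[OF y x] i by simp
  qed (use fG[OF x y] G_subset_span in auto)
qed

lemma rings_isomorphic_iff:
  assumes f: "multiplication_on G f" "\<And>i. i \<in> T \<Longrightarrow> f (e i) (e i) = u i *\<^sub>Q e i"
    and g: "multiplication_on G g" "\<And>i. i \<in> T \<Longrightarrow> g (e i) (e i) = v i *\<^sub>Q e i"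
  shows "rings_isomorphic G f g \<longleftrightarrow>
    (\<exists>c\<in>mult_ring. \<exists>c'\<in>mult_ring. \<forall>i\<in>T. c i * c' i = 1 \<and> u i = c i * v i)"
proof
  assume "rings_isomorphic G f g"
  then obtain \<phi> where bij: "bij_betw \<phi> G G"
    and hom: "\<And>x y. x \<in> G \<Longrightarrow> y \<in> G \<Longrightarrow> \<phi> (x + y) = \<phi> x + \<phi> y"
      "\<And>x y. x \<in> G \<Longrightarrow> y \<in> G \<Longrightarrow> \<phi> (f x y) = g (\<phi> x) (\<phi> y)"
    unfolding rings_isomorphic_def by blast
  \<comment> \<open>The inverse map is additive on \<open>G\<close> as well, hence diagonal with
    entries in \<open>mult_ring\<close>; this makes \<open>c\<close> a unit of that ring, not merely
    a family of nonzero rationals.\<close>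
  define \<psi> where "\<psi> = inv_into G \<phi>"
  have \<phi>G: "\<phi> x \<in> G" if "x \<in> G" for x using bij that by (auto simp: bij_betw_def)
  have \<psi>: "\<psi> x \<in> G" "\<phi> (\<psi> x) = x" if "x \<in> G" for x
    using bij that unfolding \<psi>_def by (metis bij_betw_imp_surj_on inv_into_into f_inv_into_f)+
  have \<psi>\<phi>: "\<psi> (\<phi> x) = x" if "x \<in> G" for x
    using bij that unfolding \<psi>_def by (simp add: bij_betw_def)
  have "additive_on G \<phi>" using hom by (auto simp: additive_on_def)
  then obtain c where c: "\<And>x. x \<in> G \<Longrightarrow> \<phi> x = diag c x"
    using additive_eq_diag[of \<phi>] \<phi>G by blast
  have "\<psi> (x + y) = \<psi> x + \<psi> y" if "x \<in> G" "y \<in> G" for x y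
    by (metis \<psi> \<psi>\<phi> hom(1) that add_subgroup_add[OF add_subgroup_G])
  then have "additive_on G \<psi>" by (auto simp: additive_on_def)
  then obtain c' where c': "\<And>x. x \<in> G \<Longrightarrow> \<psi> x = diag c' x"
    using additive_eq_diag[of \<psi>] \<psi>(1) by blast
  have "c \<in> mult_ring" "c' \<in> mult_ring"
    using \<phi>G \<psi>(1) c c' by (auto intro!: mult_ring_if_diag)
  moreover have "c i * c' i = 1 \<and> u i = c i * v i" if i: "i \<in> T" for i
  proof -
    have "diag c (diag c' (e i)) = e i"
      using \<psi>(2)[OF e_in_G[OF i]] \<psi>(1)[OF e_in_G[OF i]] c c'[OF e_in_G[OF i]] by simp
    then have cc': "c i * c' i = 1"
      using coord_diag[OF i, of c "diag c' (e i)"] coord_diag[OF i, of c' "e i"] i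
      by (simp add: coord_e del: coord_diag)
    have "f (e i) (e i) \<in> G" using f(1) e_in_G[OF i] by (auto simp: multiplication_on_def)
    \<comment> \<open>The \<open>i\<close>-th coordinate of the image of the square of
      \<open>e i\<close> is computed on both sides of the homomorphism law; one factor
      \<open>c i\<close> is then cancelled.\<close>
    then have "c i * u i = coord i (\<phi> (f (e i) (e i)))"
      using c i f(2)[OF i] by (simp add: coord_scale coord_e)
    also have "\<dots> = coord i (g (diag c (e i)) (diag c (e i)))"
      using hom(2) c e_in_G i by simp
    also have "\<dots> = c i * c i * v i"
      using multiplication_eq[OF g, of "diag c (e i)" "diag c (e i)"] \<phi>G c e_in_G[OF i] i
      by (simp add: coord_e)
    finally show ?thesis using cc' by auto
  qed
  ultimately show "\<exists>c\<in>mult_ring. \<exists>c'\<in>mult_ring. \<forall>i\<in>T. c i * c' i = 1 \<and> u i = c i * v i" by blast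
next
  assume "\<exists>c\<in>mult_ring. \<exists>c'\<in>mult_ring. \<forall>i\<in>T. c i * c' i = 1 \<and> u i = c i * v i"
  then obtain c c' where c: "c \<in> mult_ring" "c' \<in> mult_ring"
    and cc': "\<And>i. i \<in> T \<Longrightarrow> c i * c' i = 1" and uv: "\<And>i. i \<in> T \<Longrightarrow> u i = c i * v i" by blast
  have span: "x \<in> rat_vector.span (e ` T)" if "x \<in> G" for x using that G_subset_span by blast
  have "diag c' (diag c x) = x" "diag c (diag c' x) = x" if x: "x \<in> G" for x
    using span[OF x] cc' cc'[unfolded mult.commute[of "c _"]]
    by (auto intro!: coord_eqI simp flip: mult.assoc)
  then have "bij_betw (diag c) G G"
    using diag_in_G c by (intro bij_betw_byWitness[of _ "diag c'"]) auto
  \<comment> \<open>In coordinates both sides are the product of the coordinates of \<open>x\<close>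
    and \<open>y\<close>, with factor \<open>c i * u i\<close> on the left and
    \<open>c i * c i * v i\<close> on the right.\<close>
  moreover have "diag c (f x y) = g (diag c x) (diag c y)" if "x \<in> G" "y \<in> G" for x y
    using multiplication_eq[OF f that] multiplication_eq[OF g, of "diag c x" "diag c y"]
      diag_in_G[OF c(1)] that uv by (auto intro!: coord_eqI simp: mult_ac)
  ultimately show "rings_isomorphic G f g"
    using additive_on_diag[of c] unfolding rings_isomorphic_def additive_on_def by blast
qed

end

section \<open>Bases of the regulator\<close>

abbreviation loc_multiples :: "nat set \<Rightarrow> 'a::rat_vector \<Rightarrow> 'a set" where
  "loc_multiples P v \<equiv> (\<lambda>r. r *\<^sub>Q v) ` loc P"

lemma add_subgroup_loc_multiples: "add_subgroup (loc_multiples P v)"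
  unfolding add_subgroup_def
proof (intro conjI ballI)
  show "0 \<in> loc_multiples P v" by (rule image_eqI[of _ _ 0]) auto
  fix x y assume "x \<in> loc_multiples P v" "y \<in> loc_multiples P v"
  then obtain q r where "x = q *\<^sub>Q v" "y = r *\<^sub>Q v" "q \<in> loc P" "r \<in> loc P" by blast
  then show "x - y \<in> loc_multiples P v"
    by (intro image_eqI[of _ _ "q - r"]) (auto simp: rat_vector.scale_left_diff_distrib loc_diff)
qed

lemma of_int_in_loc_multiples: "of_int n *\<^sub>Q v \<in> loc_multiples P v"
  by (rule imageI) simp

lemma loc_multiples_base: "v \<in> loc_multiples P v"
  using of_int_in_loc_multiples[of 1 v P] by (simp add: scaleQ_one)

lemma internal_direct_sum_cong:
  assumes "I = J" "\<And>i. i \<in> J \<Longrightarrow> A i = B i" "H = K"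
  shows "internal_direct_sum I A H \<longleftrightarrow> internal_direct_sum J B K"
proof -
  have "(\<Union>j\<in>J - X. A j) = (\<Union>j\<in>J - X. B j)" for X using assms(2) by auto
  from this this[of "{}"] show ?thesis using assms by (simp add: internal_direct_sum_def)
qed

text \<open>Vanishing basis vectors generate zero summands, which a direct sum tolerates. They are
  discarded until it is shown that there are none.\<close>

lemma internal_direct_sum_remove_zero:
  assumes "internal_direct_sum I A H"
  shows "internal_direct_sum {i \<in> I. A i \<noteq> {0}} A H"
proof -
  let ?I = "{i \<in> I. A i \<noteq> {0}}"
  have "(\<Union>i\<in>I. A i) \<subseteq> add_subgroup hull (\<Union>i\<in>?I. A i)"
  proof
    fix x assume "x \<in> (\<Union>i\<in>I. A i)"
    then have "x = 0 \<or> x \<in> (\<Union>i\<in>?I. A i)" by blast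
    then show "x \<in> add_subgroup hull (\<Union>i\<in>?I. A i)"
      using add_subgroup_0[OF add_subgroup_hull] hull_inc by metis
  qed
  then have "add_subgroup hull (\<Union>i\<in>I. A i) \<subseteq> add_subgroup hull (\<Union>i\<in>?I. A i)"
    by (intro hull_minimal add_subgroup_hull)
  moreover have "add_subgroup hull (\<Union>i\<in>?I. A i) \<subseteq> add_subgroup hull (\<Union>i\<in>I. A i)"
    by (intro hull_mono) blast
  moreover have "A i \<inter> add_subgroup hull (\<Union>j\<in>?I - {i}. A j) = {0}" if i: "i \<in> I" for i
  proof -
    have "add_subgroup hull (\<Union>j\<in>?I - {i}. A j) \<subseteq> add_subgroup hull (\<Union>j\<in>I - {i}. A j)"
      by (intro hull_mono) blast
    moreover have "0 \<in> A i" using assms i by (auto simp: internal_direct_sum_def add_subgroup_0)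
    moreover have "0 \<in> add_subgroup hull (\<Union>j\<in>?I - {i}. A j)"
      by (intro add_subgroup_0 add_subgroup_hull)
    moreover have "A i \<inter> add_subgroup hull (\<Union>j\<in>I - {i}. A j) = {0}"
      using assms i by (auto simp: internal_direct_sum_def)
    ultimately show ?thesis by blast
  qed
  ultimately show ?thesis using assms by (auto simp: internal_direct_sum_def)
qed

context
  fixes I :: "'i set" and e :: "'i \<Rightarrow> 'a::rat_vector" and P :: "'i \<Rightarrow> nat set" and H :: "'a set"
  assumes sum: "internal_direct_sum I (\<lambda>i. loc_multiples (P i) (e i)) H"
    and nonzero: "\<And>i. i \<in> I \<Longrightarrow> e i \<noteq> 0"
begin

lemma direct_sum_inj_on: "inj_on e I"
proof (rule inj_onI, rule ccontr)
  fix i j assume ij: "i \<in> I" "j \<in> I" "e i = e j" "i \<noteq> j"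
  have "e i \<in> (\<Union>k\<in>I - {i}. loc_multiples (P k) (e k))"
    using ij loc_multiples_base[of "e j" "P j"] by auto
  then have "e i \<in> add_subgroup hull (\<Union>k\<in>I - {i}. loc_multiples (P k) (e k))" by (rule hull_inc)
  then have "e i = 0"
    using sum ij(1) loc_multiples_base unfolding internal_direct_sum_def by blast
  then show False using nonzero ij(1) by blast
qed

text \<open>After a rational relation is multiplied by a common denominator, each of its terms lies
  in its own summand and, up to sign, in the subgroup generated by the others.\<close>

lemma direct_sum_independent: "rat_vector.independent (e ` I)"
  unfolding rat_vector.independent_explicit_finite_subsets
proof (intro allI impI ballI)
  fix S u v assume S: "S \<subseteq> e ` I" "finite S" and zero: "(\<Sum>w\<in>S. u w *\<^sub>Q w) = 0" and v: "v \<in> S"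
  obtain N :: int where N: "N > 0" "\<And>w. w \<in> S \<Longrightarrow> of_int N * u w \<in> \<int>"
    using common_denominator[OF S(2), of u] by blast
  then have "\<forall>w\<in>S. \<exists>n. of_int N * u w = of_int n" by (meson Ints_cases)
  then obtain n where n: "\<And>w. w \<in> S \<Longrightarrow> of_int N * u w = of_int (n w)" by metis
  have "0 = of_int N *\<^sub>Q (\<Sum>w\<in>S. u w *\<^sub>Q w)" using zero by simp
  also have "\<dots> = (\<Sum>w\<in>S. of_int (n w) *\<^sub>Q w)"
    using n by (simp add: rat_vector.scale_sum_right scaleQ_scaleQ)
  also have "\<dots> = of_int (n v) *\<^sub>Q v + (\<Sum>w\<in>S - {v}. of_int (n w) *\<^sub>Q w)"
    using S(2) v by (simp add: sum.remove)
  finally have eq: "of_int (n v) *\<^sub>Q v = - (\<Sum>w\<in>S - {v}. of_int (n w) *\<^sub>Q w)"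
    by (simp add: eq_neg_iff_add_eq_0)
  obtain i where i: "i \<in> I" "v = e i" using S(1) v by blast
  have "(\<Sum>w\<in>S - {v}. of_int (n w) *\<^sub>Q w) \<in> add_subgroup hull (\<Union>j\<in>I - {i}. loc_multiples (P j) (e j))"
  proof (intro add_subgroup_sum[OF add_subgroup_hull] hull_inc)
    fix w assume "w \<in> S - {v}"
    then obtain j where j: "j \<in> I - {i}" "w = e j" using S(1) i by blast
    show "of_int (n w) *\<^sub>Q w \<in> (\<Union>j\<in>I - {i}. loc_multiples (P j) (e j))"
      unfolding j(2) by (rule UN_I[OF j(1) of_int_in_loc_multiples])
  qed
  then have "of_int (n v) *\<^sub>Q v \<in> add_subgroup hull (\<Union>j\<in>I - {i}. loc_multiples (P j) (e j))"
    unfolding eq by (rule add_subgroup_minus[OF add_subgroup_hull])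
  moreover have "of_int (n v) *\<^sub>Q v \<in> loc_multiples (P i) (e i)"
    unfolding i(2) by (rule of_int_in_loc_multiples)
  ultimately have "of_int (n v) *\<^sub>Q v = 0"
    using sum i(1) unfolding internal_direct_sum_def by blast
  then have "n v = 0" using nonzero i by simp
  then show "u v = 0" using n[OF v] N(1) by simp
qed

text \<open>Needed so that the decomposition picked by \<open>SOME\<close> in
  \<open>Reg_comp\<close> really is one. Passing from the family to the set of its members is safe:
  removing \<open>D\<close> removes at least the index \<open>i\<close>.\<close>

lemma direct_sum_completely_decomposable: "completely_decomposable H"
proof -
  define A where "A i = loc_multiples (P i) (e i)" for i
  have sum: "internal_direct_sum I A H" using sum unfolding A_def .
  have "rank_one (A i)" if i: "i \<in> I" for i
    unfolding rank_one_def
  proof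
    show "add_subgroup (A i)" unfolding A_def by (rule add_subgroup_loc_multiples)
    show "rat_vector.dim (A i) = 1"
    proof (rule rat_vector.dim_unique)
      show "{e i} \<subseteq> A i" unfolding A_def using loc_multiples_base by blast
      show "A i \<subseteq> rat_vector.span {e i}" by (auto simp: A_def rat_vector.span_singleton)
    qed (use nonzero[OF i] in auto)
  qed
  moreover have "internal_direct_sum (A ` I) (\<lambda>D. D) H"
    unfolding internal_direct_sum_def
  proof (intro conjI ballI)
    fix D assume "D \<in> A ` I"
    then obtain i where i: "i \<in> I" "D = A i" by blast
    show D: "add_subgroup D" using sum i by (simp add: internal_direct_sum_def)
    have "add_subgroup hull (\<Union>E\<in>A ` I - {D}. E) \<subseteq> add_subgroup hull (\<Union>j\<in>I - {i}. A j)"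
      using i(2) by (intro hull_mono) blast
    moreover have "D \<inter> add_subgroup hull (\<Union>j\<in>I - {i}. A j) = {0}"
      using sum i by (simp add: internal_direct_sum_def)
    ultimately show "D \<inter> add_subgroup hull (\<Union>E\<in>A ` I - {D}. E) = {0}"
      using add_subgroup_0[OF D] add_subgroup_0[OF add_subgroup_hull] by blast
  qed (use sum in \<open>simp add: internal_direct_sum_def\<close>)
  ultimately show ?thesis
    unfolding completely_decomposable_def rank_one_decomposition_def by blast
qed

end

section \<open>The regulator and its invariants in a basis\<close>

text \<open>An intersection over an empty family would be everything, so a completely decomposable
  subgroup of least index has to be exhibited.\<close>

lemma Reg_subset:
  assumes "ACD G"
  shows "Reg G \<subseteq> G"
proof -
  obtain H0 where "cd_finite_index G H0" using assms unfolding ACD_def by blast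
  then obtain H where H: "cd_finite_index G H"
      "\<And>H'. cd_finite_index G H' \<Longrightarrow> card (cosets G H) \<le> card (cosets G H')"
    using ex_has_least_nat[of "cd_finite_index G" H0 "\<lambda>H. card (cosets G H)"] by blast
  then have "Reg G \<subseteq> H" unfolding Reg_def by (intro Inter_lower) simp
  also have "H \<subseteq> G" using H(1) by (simp add: cd_finite_index_def)
  finally show ?thesis .
qed

lemma subset_span_singleton_if_dim_1:
  fixes S :: "'a::rat_vector set"
  assumes "rat_vector.dim S = 1" "b \<in> S" "b \<noteq> 0"
  shows "S \<subseteq> rat_vector.span {b}"
proof -
  obtain B where B: "B \<subseteq> S" "S \<subseteq> rat_vector.span B" "card B = 1"
    using rat_vector.basis_exists[of S] assms(1) by metis
  then obtain b' where "B = {b'}" using card_1_singletonE by blast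
  with B assms(2) obtain q where "b = q *\<^sub>Q b'" by (auto simp: rat_vector.span_singleton)
  with assms(3) have "b' = (1 / q) *\<^sub>Q b" by (auto simp: scaleQ_scaleQ scaleQ_one)
  then have "rat_vector.span {b'} \<subseteq> rat_vector.span {b}"
    by (intro rat_vector.span_minimal) (auto simp: rat_vector.span_base rat_vector.span_scale)
  then show ?thesis using B \<open>B = {b'}\<close> by blast
qed

lemma types_obtain_divisible:
  assumes "completely_decomposable (Reg G)" "\<tau> \<in> types G"
  obtains h where "h \<noteq> 0" "h \<in> Reg G" "\<And>p k. p \<in> P_inf \<tau> \<Longrightarrow> \<exists>y\<in>Reg G. of_nat (p ^ k) *\<^sub>Q y = h"
proof -
  define F where "F = (SOME F. rank_one_decomposition (Reg G) F)"
  have F: "rank_one_decomposition (Reg G) F"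
    using assms(1) someI_ex unfolding F_def completely_decomposable_def by metis
  have "Reg_comp G \<tau> \<noteq> {0}" using assms(2) by (simp add: types_def)
  then have ne: "add_subgroup hull (\<Union>{D \<in> F. group_type D = \<tau>}) \<noteq> {0}"
    by (simp add: Reg_comp_def F_def)
  have "\<exists>D\<in>F. group_type D = \<tau> \<and> (\<exists>x\<in>D. x \<noteq> 0)"
  proof (rule ccontr)
    assume "\<not> ?thesis"
    then have "add_subgroup hull (\<Union>{D \<in> F. group_type D = \<tau>}) \<subseteq> {0}"
      by (intro hull_minimal) (auto simp: add_subgroup_def)
    then show False using ne add_subgroup_0[OF add_subgroup_hull] by blast
  qed
  then obtain D x where D: "D \<in> F" "group_type D = \<tau>" "x \<in> D" "x \<noteq> 0" by blast
  \<comment> \<open>The same term as in \<open>group_type\<close>, so the type of \<open>D\<close>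
    gives the heights of this very element and no independence of the choice is required.\<close>
  define h where "h = (SOME h. h \<in> D \<and> h \<noteq> 0)"
  have h: "h \<in> D" "h \<noteq> 0"
    unfolding atomize_conj h_def by (rule someI[of _ x]) (use D in simp)
  have "add_subgroup D" using F D(1) by (simp add: rank_one_decomposition_def rank_one_def)
  have "D \<subseteq> (\<Union>D\<in>F. D)" using D(1) by blast
  also have "\<dots> \<subseteq> Reg G"
    using F hull_subset unfolding rank_one_decomposition_def internal_direct_sum_def by metis
  finally have "D \<subseteq> Reg G" .
  have "\<exists>y\<in>Reg G. of_nat (p ^ k) *\<^sub>Q y = h" if "p \<in> P_inf \<tau>" for p k
  proof -
    have "height D h p = \<infinity>"
      using that D(2) P_inf_abs[of "height D h"] by (auto simp: group_type_def h_def)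
    then show ?thesis
      using height_eq_infinity_iff[OF \<open>add_subgroup D\<close>] \<open>D \<subseteq> Reg G\<close> by blast
  qed
  then show thesis using that h \<open>D \<subseteq> Reg G\<close> by blast
qed

text \<open>A frame is first built on the indices with nonzero basis vector. A type outside this set
  would still contribute a nonzero element of the regulator divisible by all powers of its primes;
  by incomparability all coordinates of that element vanish, a contradiction.\<close>

lemma frame_of_r_basis:
  assumes G: "rigid G" "ring_type G" and e: "r_basis_extending G e0 e"
  shows "rational_frame (types G) e" (is ?frame)
    and "Reg G = rational_frame.lattice (types G) e P_inf" (is ?lattice)
proof -
  let ?T = "types G" and ?T' = "{\<tau> \<in> types G. e \<tau> \<noteq> 0}"
  have idem: "idempotent_type \<tau>" if "\<tau> \<in> ?T" for \<tau> using G(2) that by (simp add: ring_type_def)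
  have ACD: "ACD G" using G(1) by (simp add: rigid_def block_rigid_def)
  have incomp: "\<not> P_inf \<sigma> \<subseteq> P_inf \<tau>" if "\<sigma> \<in> ?T" "\<tau> \<in> ?T" "\<sigma> \<noteq> \<tau>" for \<sigma> \<tau>
    using G(1) that type_le_if_P_inf_subset[OF idem idem] unfolding rigid_def block_rigid_def by blast
  let ?A = "\<lambda>\<tau>. loc_multiples (P_inf \<tau>) (e \<tau>)"
  have "R_multiples \<tau> (e \<tau>) = ?A \<tau>" if "\<tau> \<in> ?T" for \<tau>
    using R_type_eq_loc[OF idem[OF that]] by (simp add: R_multiples_def)
  then have sum: "internal_direct_sum ?T ?A (Reg G)"
    using e unfolding r_basis_extending_def by (simp cong: internal_direct_sum_cong)
  have "?A \<tau> \<noteq> {0} \<longleftrightarrow> e \<tau> \<noteq> 0" for \<tau>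
    using loc_multiples_base[of "e \<tau>" "P_inf \<tau>"] by auto
  then have sum': "internal_direct_sum ?T' ?A (Reg G)"
    using internal_direct_sum_remove_zero[OF sum] by simp
  have ind: "rat_vector.independent (e ` ?T')" by (rule direct_sum_independent[OF sum']) simp
  have inj: "inj_on e ?T'" by (rule direct_sum_inj_on[OF sum']) simp
  have Reg: "Reg G = add_subgroup hull (\<Union>\<tau>\<in>?T'. ?A \<tau>)"
    using sum' by (simp add: internal_direct_sum_def)
  obtain S where S: "finite S" "G \<subseteq> rat_vector.span S" using ACD by (auto simp: ACD_def finite_rank_def)
  have "e \<tau> \<in> Reg G" if "\<tau> \<in> ?T'" for \<tau>
    unfolding Reg using that loc_multiples_base by (intro hull_inc) blast
  then have "e ` ?T' \<subseteq> rat_vector.span S" using Reg_subset[OF ACD] S(2) by blast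
  \<comment> \<open>Finiteness comes from the finite rank of \<open>G\<close>, in which the
    independent vectors lie.\<close>
  then have "finite (e ` ?T')" using rat_vector.independent_span_bound[OF S(1) ind] by blast
  then have "finite ?T'" using inj by (rule finite_imageD)
  then interpret F: rational_frame ?T' e P_inf using inj ind by unfold_locales
  have lattice: "Reg G = F.lattice" using Reg F.lattice_eq_hull by simp
  have "completely_decomposable (Reg G)" by (rule direct_sum_completely_decomposable[OF sum']) simp
  have "e \<tau> \<noteq> 0" if \<tau>: "\<tau> \<in> ?T" for \<tau>
  proof
    assume zero: "e \<tau> = 0"
    obtain h where h: "h \<noteq> 0" "h \<in> Reg G" "\<And>p k. p \<in> P_inf \<tau> \<Longrightarrow> \<exists>y\<in>Reg G. of_nat (p ^ k) *\<^sub>Q y = h"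
      using types_obtain_divisible[OF \<open>completely_decomposable (Reg G)\<close> \<tau>] by blast
    have "F.coord \<sigma> h = 0" if \<sigma>: "\<sigma> \<in> ?T'" for \<sigma>
    proof -
      \<comment> \<open>\<sigma> differs from \<tau> because \<open>e \<sigma>\<close> is nonzero
        and \<open>e \<tau>\<close> is assumed to be zero.\<close>
      obtain p where p: "p \<in> P_inf \<tau>" "p \<notin> P_inf \<sigma>" using incomp[of \<tau> \<sigma>] \<tau> \<sigma> zero by blast
      have prime: "prime p" using P_inf_prime p(1) .
      have "F.coord \<sigma> h / of_nat p ^ k \<in> loc (P_inf \<sigma>)" for k
      proof -
        obtain y where y: "y \<in> F.lattice" "of_nat (p ^ k) *\<^sub>Q y = h" using h(3)[OF p(1)] lattice by blast
        then have "F.coord \<sigma> h = of_nat (p ^ k) * F.coord \<sigma> y"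
          using F.coord_scale F.lattice_subset_span by blast
        then have "F.coord \<sigma> h / of_nat p ^ k = F.coord \<sigma> y" using prime_gt_0_nat[OF prime] by simp
        then show ?thesis using y(1) \<sigma> by (simp add: F.lattice_def)
      qed
      then show ?thesis using loc_divisible_imp_zero[OF prime p(2)] by blast
    qed
    then have "h = 0"
      using h(2) lattice F.lattice_subset_span by (intro F.coord_eqI) (auto simp: rat_vector.span_zero)
    then show False using h(1) by blast
  qed
  then have "?T' = ?T" by blast
  then show ?frame ?lattice using F.rational_frame_axioms lattice by simp_all
qed

text \<open>\<open>LEAST\<close> guarantees positivity only if some candidate exists. The projection
  of the generator is its coordinate times \<open>e \<tau>\<close>, and the denominator of that
  coordinate is a candidate.\<close>

lemma m_inv_pos:
  assumes frame: "rational_frame (types G) e" and lattice: "Reg G = rational_frame.lattice (types G) e P_inf"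
    and G: "rigid G" "G \<subseteq> rat_vector.span (e ` types G)" "cyclic_regulator_quotient G"
    and e: "\<And>\<sigma>. \<sigma> \<in> types G \<Longrightarrow> e \<sigma> \<in> Reg_comp G \<sigma>"
    and \<tau>: "\<tau> \<in> types G"
  shows "m_inv G \<tau> > 0"
proof -
  interpret F: rational_frame "types G" e P_inf by (rule frame)
  \<comment> \<open>By rigidity the component has rank one, so it lies on the line of its nonzero
    basis vector.\<close>
  have comp: "Reg_comp G \<sigma> \<subseteq> rat_vector.span {e \<sigma>}" if "\<sigma> \<in> types G" for \<sigma>
    using G(1) that e F.e_nonzero by (intro subset_span_singleton_if_dim_1) (auto simp: rigid_def rank_one_def)
  \<comment> \<open>The generator chosen inside \<open>m_inv\<close>, which may differ from the one
    that witnesses an rc-basis.\<close>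
  define d where "d = (SOME d. generates_quotient G (Reg G) d)"
  have "generates_quotient G (Reg G) d"
    using G(3) someI_ex unfolding cyclic_regulator_quotient_def d_def by metis
  then have d: "d \<in> rat_vector.span (e ` types G)" using G(2) by (auto simp: generates_quotient_def)
  have proj: "type_proj G \<tau> d = F.coord \<tau> d *\<^sub>Q e \<tau>"
    unfolding type_proj_def
  proof (rule the_equality, safe)
    show "F.coord \<tau> d *\<^sub>Q e \<tau> \<in> rat_vector.span (Reg_comp G \<tau>)"
      using e[OF \<tau>] by (intro rat_vector.span_scale rat_vector.span_base)
    have "d - F.coord \<tau> d *\<^sub>Q e \<tau> \<in> rat_vector.span (e ` (types G - {\<tau>}))"
      using d \<tau> by (simp add: F.span_diff_singleton_iff F.coord_diff F.coord_scale F.coord_e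
        rat_vector.span_diff rat_vector.span_scale)
    moreover have "e ` (types G - {\<tau>}) \<subseteq> (\<Union>\<sigma>\<in>types G - {\<tau>}. Reg_comp G \<sigma>)" using e by blast
    ultimately show "d - F.coord \<tau> d *\<^sub>Q e \<tau> \<in> rat_vector.span (\<Union>\<sigma>\<in>types G - {\<tau>}. Reg_comp G \<sigma>)"
      using rat_vector.span_mono by blast
  next
    fix x assume x: "x \<in> rat_vector.span (Reg_comp G \<tau>)"
      and dx: "d - x \<in> rat_vector.span (\<Union>\<sigma>\<in>types G - {\<tau>}. Reg_comp G \<sigma>)"
    have "x \<in> rat_vector.span {e \<tau>}"
      using x comp[OF \<tau>] rat_vector.span_minimal rat_vector.subspace_span by blast
    then obtain q where q: "x = q *\<^sub>Q e \<tau>" by (auto simp: rat_vector.span_singleton)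
    have "(\<Union>\<sigma>\<in>types G - {\<tau>}. Reg_comp G \<sigma>) \<subseteq> rat_vector.span (e ` (types G - {\<tau>}))"
    proof (rule UN_least)
      fix \<sigma> assume \<sigma>: "\<sigma> \<in> types G - {\<tau>}"
      have "rat_vector.span {e \<sigma>} \<subseteq> rat_vector.span (e ` (types G - {\<tau>}))"
        using \<sigma> by (intro rat_vector.span_mono) blast
      then show "Reg_comp G \<sigma> \<subseteq> rat_vector.span (e ` (types G - {\<tau>}))" using comp \<sigma> by blast
    qed
    then have "d - x \<in> rat_vector.span (e ` (types G - {\<tau>}))"
      using dx rat_vector.span_minimal[OF _ rat_vector.subspace_span] by blast
    then have "F.coord \<tau> (d - x) = 0" using F.span_diff_singleton_iff[OF \<tau>] by blast
    then have "F.coord \<tau> d = q"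
      using d \<tau> by (simp add: q F.coord_diff F.coord_scale F.coord_e rat_vector.span_scale)
    then show "x = F.coord \<tau> d *\<^sub>Q e \<tau>" using q by simp
  qed
  obtain a b where ab: "F.coord \<tau> d = of_int a / of_int b" "b > 0" by (rule rat_obtain)
  have "of_nat (nat b) *\<^sub>Q type_proj G \<tau> d = of_int a *\<^sub>Q e \<tau>"
    using ab by (simp add: proj scaleQ_scaleQ)
  also have "\<dots> \<in> Reg G" unfolding lattice by (intro F.scale_e_in_lattice \<tau> loc_of_int)
  finally have "0 < nat b \<and> of_nat (nat b) *\<^sub>Q type_proj G \<tau> d \<in> Reg G" using ab(2) by simp
  then show ?thesis unfolding m_inv_def d_def by (rule LeastI2) blast
qed

text \<open>The families of this shape form a subgroup containing the generators. The coefficients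
  \<open>u\<close> feed the coordinate calculus, and vanishing outside \<open>types G\<close>
  permits comparison as functions.\<close>

lemma M_group_components:
  assumes "U \<in> M_group G e s'"
  obtains u where "\<And>\<tau>. \<tau> \<in> types G \<Longrightarrow> U \<tau> = u \<tau> *\<^sub>Q e \<tau>" and "\<And>\<tau>. \<tau> \<notin> types G \<Longrightarrow> U \<tau> = 0"
proof -
  let ?S = "{U. (\<forall>\<tau>\<in>types G. \<exists>q. U \<tau> = q *\<^sub>Q e \<tau>) \<and> (\<forall>\<tau>. \<tau> \<notin> types G \<longrightarrow> U \<tau> = 0)}"
  have "add_subgroup ?S"
    unfolding add_subgroup_def
  proof (intro conjI ballI)
    show "0 \<in> ?S" by (auto intro: exI[of _ 0])
    fix U V assume "U \<in> ?S" "V \<in> ?S"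
    then show "U - V \<in> ?S" by (auto simp: fun_diff_def) (metis rat_vector.scale_left_diff_distrib)
  qed
  then have "M_group G e s' \<subseteq> ?S"
    unfolding M_group_def
    by (intro hull_minimal) (auto simp: M_sq_def types0_def intro: exI[of _ 0])
  then have "\<forall>\<tau>\<in>types G. \<exists>q. U \<tau> = q *\<^sub>Q e \<tau>" "\<And>\<tau>. \<tau> \<notin> types G \<Longrightarrow> U \<tau> = 0"
    using assms by auto
  then show thesis using that by metis
qed

section \<open>Transfer from frames to rigid groups\<close>

theorem theorem2p4:
  fixes G G1 C :: "'a::rat_vector set"
    and e0 e :: "gtype \<Rightarrow> 'a"
    and d :: 'a
    and s s' :: "gtype \<Rightarrow> int"
    and star times :: "'a \<Rightarrow> 'a \<Rightarrow> 'a"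
    and U_star U_times :: "gtype \<Rightarrow> 'a"
  assumes "class_A0 G" and "rigid G"
    and "main_decomposition G G1 C"
    and "rc_basis_via G G1 e0 d s"
    and "\<forall>\<tau>\<in>types0 G. [s \<tau> * s' \<tau> = 1] (mod int (m_inv G \<tau>))"
    and "r_basis_extending G e0 e"
    and "U_star \<in> M_group G e s'" and "U_times \<in> M_group G e s'"
    and "determines_ring G e U_star star"
    and "determines_ring G e U_times times"
  shows "rings_isomorphic G star times \<longleftrightarrow>
    (\<exists>c\<in>K_units G. U_star = (\<lambda>\<tau>. c \<tau> *\<^sub>Q U_times \<tau>))"
proof -
  have ring_type: "ring_type G" and cyc: "cyclic_regulator_quotient G" and rigid: "block_rigid G"
    using assms(1) by (simp_all add: class_A0_def)
  then have ACD: "ACD G" by (simp add: block_rigid_def)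
  have idem: "idempotent_type \<tau>" if "\<tau> \<in> types G" for \<tau> using ring_type that by (simp add: ring_type_def)
  have R: "R_type \<tau> = loc (P_inf \<tau>)" if "\<tau> \<in> types G" for \<tau> using R_type_eq_loc idem that by blast
  interpret F: rational_frame "types G" e P_inf
    by (rule frame_of_r_basis[OF assms(2) ring_type assms(6)])
  have lattice: "Reg G = F.lattice" by (rule frame_of_r_basis[OF assms(2) ring_type assms(6)])
  have d: "d \<in> G" "\<And>g. g \<in> G \<Longrightarrow> \<exists>n. g - of_int n *\<^sub>Q d \<in> F.lattice"
    and d_sum: "d = (\<Sum>\<tau>\<in>types0 G. (of_int (s \<tau>) / of_nat (m_inv G \<tau>)) *\<^sub>Q e0 \<tau>)"
    and coprime: "\<And>\<tau>. \<tau> \<in> types0 G \<Longrightarrow> coprime (s \<tau>) (int (m_inv G \<tau>))"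
    using assms(4) by (auto simp: rc_basis_via_def generates_quotient_def lattice)
  have T0: "types0 G \<subseteq> types G" by (auto simp: types0_def)
  have d_eq: "d = (\<Sum>\<tau>\<in>types0 G. (of_int (s \<tau>) / of_nat (m_inv G \<tau>)) *\<^sub>Q e \<tau>)"
    unfolding d_sum using assms(6) by (intro sum.cong) (auto simp: r_basis_extending_def)
  have "add_subgroup G" using ACD by (simp add: ACD_def)
  have G_eq: "G = {of_int n *\<^sub>Q d + a |n a. a \<in> F.lattice}"
  proof (intro set_eqI iffI)
    fix g assume "g \<in> G"
    then obtain n where "g - of_int n *\<^sub>Q d \<in> F.lattice" using d(2) by blast
    moreover have "g = of_int n *\<^sub>Q d + (g - of_int n *\<^sub>Q d)" by simp
    ultimately show "g \<in> {of_int n *\<^sub>Q d + a |n a. a \<in> F.lattice}" by blast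
  next
    fix g assume "g \<in> {of_int n *\<^sub>Q d + a |n a. a \<in> F.lattice}"
    then obtain n a where "g = of_int n *\<^sub>Q d + a" "a \<in> F.lattice" by blast
    then show "g \<in> G"
      using add_subgroup_add[OF \<open>add_subgroup G\<close>] add_subgroup_of_int[OF \<open>add_subgroup G\<close> d(1)]
        Reg_subset[OF ACD] lattice by blast
  qed
  have d_span: "d \<in> rat_vector.span (e ` types G)"
    unfolding d_eq
    by (rule subsetD[OF rat_vector.span_mono[OF image_mono[OF T0]] F.comb_in_span[OF T0]])
  have G_span: "G \<subseteq> rat_vector.span (e ` types G)"
  proof
    fix g assume "g \<in> G"
    then obtain n where "g - of_int n *\<^sub>Q d \<in> rat_vector.span (e ` types G)"
      using d(2) F.lattice_subset_span by blast
    then have "g - of_int n *\<^sub>Q d + of_int n *\<^sub>Q d \<in> rat_vector.span (e ` types G)"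
      by (intro rat_vector.span_add rat_vector.span_scale d_span)
    then show "g \<in> rat_vector.span (e ` types G)" by simp
  qed
  have m_pos: "m_inv G \<tau> > 0" if "\<tau> \<in> types G" for \<tau>
    by (rule m_inv_pos[OF F.rational_frame_axioms lattice assms(2) G_span cyc _ that])
      (use assms(6) in \<open>simp add: r_basis_extending_def\<close>)
  interpret C: cyclic_extension_frame "types G" e P_inf G d "types0 G" s "m_inv G"
  proof unfold_locales
    show "\<not> P_inf \<sigma> \<subseteq> P_inf \<tau>" if "\<sigma> \<in> types G" "\<tau> \<in> types G" "\<sigma> \<noteq> \<tau>" for \<sigma> \<tau>
      using rigid that type_le_if_P_inf_subset[OF idem idem] unfolding block_rigid_def by blast
    \<comment> \<open>\<open>types0\<close> collects the types with value above 1, so positivity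
      leaves only the value 1.\<close>
    show "m_inv G \<tau> = 1" if "\<tau> \<in> types G - types0 G" for \<tau>
      using that m_pos[of \<tau>] by (auto simp: types0_def)
  qed (use P_inf_prime T0 m_pos coprime d_eq G_eq in blast)+
  have K_iff: "c \<in> K_ring G \<longleftrightarrow> c \<in> C.mult_ring \<and> (\<forall>\<tau>. \<tau> \<notin> types G \<longrightarrow> c \<tau> = 0)" for c
  proof
    assume "c \<in> K_ring G"
    then show "c \<in> C.mult_ring \<and> (\<forall>\<tau>. \<tau> \<notin> types G \<longrightarrow> c \<tau> = 0)"
      using T0 by (fastforce simp: K_ring_def C.mult_ring_def R)
  next
    assume c: "c \<in> C.mult_ring \<and> (\<forall>\<tau>. \<tau> \<notin> types G \<longrightarrow> c \<tau> = 0)"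
    then obtain n where "\<forall>\<tau>\<in>types G. \<exists>r\<in>loc (P_inf \<tau>).
        c \<tau> = of_int n * of_bool (\<tau> \<in> types0 G) + of_nat (m_inv G \<tau>) * r"
      unfolding C.mult_ring_def by blast
    then obtain r where r: "\<And>\<tau>. \<tau> \<in> types G \<Longrightarrow> r \<tau> \<in> loc (P_inf \<tau>)"
      "\<And>\<tau>. \<tau> \<in> types G \<Longrightarrow> c \<tau> = of_int n * of_bool (\<tau> \<in> types0 G) + of_nat (m_inv G \<tau>) * r \<tau>"
      by metis
    have "c = (\<lambda>\<tau>. of_int n * of_bool (\<tau> \<in> types0 G) +
        (if \<tau> \<in> types G then of_nat (m_inv G \<tau>) * r \<tau> else 0))"
      using c r(2) T0 by (auto simp: fun_eq_iff)
    moreover have "\<forall>\<tau>\<in>types G. r \<tau> \<in> R_type \<tau>" using r(1) R by blast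
    ultimately show "c \<in> K_ring G" unfolding K_ring_def by blast
  qed
  obtain u where u: "\<And>\<tau>. \<tau> \<in> types G \<Longrightarrow> U_star \<tau> = u \<tau> *\<^sub>Q e \<tau>" "\<And>\<tau>. \<tau> \<notin> types G \<Longrightarrow> U_star \<tau> = 0"
    using M_group_components[OF assms(7)] by blast
  obtain v where v: "\<And>\<tau>. \<tau> \<in> types G \<Longrightarrow> U_times \<tau> = v \<tau> *\<^sub>Q e \<tau>" "\<And>\<tau>. \<tau> \<notin> types G \<Longrightarrow> U_times \<tau> = 0"
    using M_group_components[OF assms(8)] by blast
  have "rings_isomorphic G star times \<longleftrightarrow>
      (\<exists>c\<in>C.mult_ring. \<exists>c'\<in>C.mult_ring. \<forall>\<tau>\<in>types G. c \<tau> * c' \<tau> = 1 \<and> u \<tau> = c \<tau> * v \<tau>)"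
    using assms(9,10) u v by (intro C.rings_isomorphic_iff) (auto simp: determines_ring_def)
  also have "\<dots> \<longleftrightarrow> (\<exists>c\<in>K_units G. U_star = (\<lambda>\<tau>. c \<tau> *\<^sub>Q U_times \<tau>))"
  proof
    assume "\<exists>c\<in>C.mult_ring. \<exists>c'\<in>C.mult_ring. \<forall>\<tau>\<in>types G. c \<tau> * c' \<tau> = 1 \<and> u \<tau> = c \<tau> * v \<tau>"
    then obtain c c' where c: "c \<in> C.mult_ring" "c' \<in> C.mult_ring"
      and cc': "\<And>\<tau>. \<tau> \<in> types G \<Longrightarrow> c \<tau> * c' \<tau> = 1" and uv: "\<And>\<tau>. \<tau> \<in> types G \<Longrightarrow> u \<tau> = c \<tau> * v \<tau>"
      by blast
    \<comment> \<open>Truncation to \<open>types G\<close>, since elements of \<open>K_ring\<close>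
      vanish elsewhere and its identity is the indicator function of \<open>types G\<close>.\<close>
    define b b' where "b \<tau> = (if \<tau> \<in> types G then c \<tau> else 0)"
      and "b' \<tau> = (if \<tau> \<in> types G then c' \<tau> else 0)" for \<tau>
    have "b \<in> K_ring G" "b' \<in> K_ring G"
      using c by (simp_all add: K_iff C.mult_ring_def b_def b'_def)
    moreover have "b * b' = (\<lambda>\<tau>. of_bool (\<tau> \<in> types G))"
      using cc' by (auto simp: b_def b'_def fun_eq_iff)
    ultimately have "b \<in> K_units G" unfolding K_units_def by blast
    moreover have "U_star = (\<lambda>\<tau>. b \<tau> *\<^sub>Q U_times \<tau>)"
    proof
      fix \<tau> show "U_star \<tau> = b \<tau> *\<^sub>Q U_times \<tau>"
        using u[of \<tau>] v[of \<tau>] uv[of \<tau>] by (cases "\<tau> \<in> types G") (simp_all add: b_def scaleQ_scaleQ)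
    qed
    ultimately show "\<exists>c\<in>K_units G. U_star = (\<lambda>\<tau>. c \<tau> *\<^sub>Q U_times \<tau>)" by blast
  next
    assume "\<exists>c\<in>K_units G. U_star = (\<lambda>\<tau>. c \<tau> *\<^sub>Q U_times \<tau>)"
    then obtain c c' where c: "c \<in> K_ring G" "c' \<in> K_ring G" "c * c' = (\<lambda>\<tau>. of_bool (\<tau> \<in> types G))"
      and U: "U_star = (\<lambda>\<tau>. c \<tau> *\<^sub>Q U_times \<tau>)" unfolding K_units_def by blast
    have "c \<tau> * c' \<tau> = 1 \<and> u \<tau> = c \<tau> * v \<tau>" if \<tau>: "\<tau> \<in> types G" for \<tau>
    proof
      show "c \<tau> * c' \<tau> = 1" using fun_cong[OF c(3), of \<tau>] \<tau> by simp
      \<comment> \<open>Coefficients may be compared because the frame guarantees that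
        \<open>e \<tau>\<close> is nonzero.\<close>
      have "u \<tau> *\<^sub>Q e \<tau> = (c \<tau> * v \<tau>) *\<^sub>Q e \<tau>"
        using fun_cong[OF U, of \<tau>] u v \<tau> by (simp add: scaleQ_scaleQ)
      then show "u \<tau> = c \<tau> * v \<tau>" using F.e_nonzero[OF \<tau>] by simp
    qed
    then show "\<exists>c\<in>C.mult_ring. \<exists>c'\<in>C.mult_ring. \<forall>\<tau>\<in>types G. c \<tau> * c' \<tau> = 1 \<and> u \<tau> = c \<tau> * v \<tau>"
      using c(1,2) K_iff by blast
  qed
  finally show ?thesis .
qed

end
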